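(* Let $G$ be a parity game, with the concrete measure structure and operators $\mathrm{prg}_\bot$, $\mathrm{prg}_+$ defined in the context, and let $\mathrm{SQDMF}$ be the set of measure functions that are both simple measure functions and quasi-dominion measures. The solver operator $\mathrm{sol}:\mathrm{SQDMF}\to\mathrm{SQDMF}$ is a well-defined function. Moreover, for every $\mu\in\mathrm{SQDMF}$ there exists an index $k\le d$ such that $\mathrm{sol}(\mu)=F^k(\mu)$, where $F=\mathrm{prg}_+\circ\mathrm{prg}_\bot$ and $d\in\mathbb{N}$ is the depth of the finite partial order $(\mathrm{SMF},\sqsubseteq)$ of simple measure functions (the maximal number of elements of a strict chain in it).
   Context: Parity game: finite disjoint sets $V_0, V_1$ of positions of player 0 and player 1, $V = V_0\cup V_1$, a move relation $E\subseteq V\times V$ in which every position has a successor ($E(v)=\{w:(v,w)\in E\}\neq\emptyset$), and a priority function $p: V\to P$, $P\subset\mathbb{N}$ finite. For $U\subseteq V$ and $\alpha\in\{0,1\}$, a positional $\alpha$-strategy on $U$ is a map $\sigma:U\cap V_\alpha\to V$ with $(v,\sigma(v))\in E$. For $(\sigma_0,\sigma_1)$ strategies on $U$ and $v\in U$, the play from $v$ in $U$ is the maximal (finite or infinite) sequence of positions of $U$ starting at $v$ in which each successor of a $V_\alpha$-position is given by $\sigma_\alpha$. The priority of an infinite play is the maximal priority occurring infinitely often. $U$ is a 0-dominion if some 0-strategy $\sigma_0$ on $U$ ensures that, for every 1-strategy on $U$ and $v\in U$, the play is infinite with even priority. Evaluations: $\mathbb{Z}^P$ = functions $P\to\mathbb{Z}$,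 pointwise sum/difference, $\mathbf 0$ null. $\eta_1<\eta_2$ iff for the greatest $k$ with $\eta_1(k)\neq\eta_2(k)$: $\eta_1(k)<\eta_2(k)$ if $k$ even, $\eta_1(k)>\eta_2(k)$ if $k$ odd. $\delta_i(i)=1$, $\delta_i(j)=0$ for $j\ne i$. Concrete measure structure: $M^+$ = set of $\eta\in\mathbb{Z}^P$ with all $\eta(k)\ge0$ and either $\eta=\mathbf 0$ or the greatest $k$ with $\eta(k)\neq0$ even; $M=M^+\cup\{\top\}$, $\bot=\mathbf 0$, $\eta<\top$ for $\eta\in M^+$. Truncation: $\top\upharpoonright_v=\top$; $(\eta\upharpoonright_v)(k)=\eta(k)$ if $k\ge p(v)$, else $0$. Stretch: $\top+v=\top$; $\eta+v=\max\{\bot,\eta+\delta_{p(v)}\}$. Measure functions $\mu:V\to M$, ordered pointwise by $\sqsubseteq$. $D_0(\mu)=\{v:\mu(v)\upharpoonright_v=\top\}$, $D_\bot(\mu)=\{v:\mu(v)\upharpoonright_v=\bot\}$, $D_+(\mu)=V\setminus D_\bot(\mu)$. Measure of a finite path: $\mathrm{msr}(\varepsilon)=\bot$, $\mathrm{msr}(v\cdot\pi')=\mathrm{msr}(\pi')+v$. For $X\subseteq V$, $S(v,X)=\{\mathrm{msr}(\pi):\pi$ a finite simple path starting at $v$ all of whose positions lie in $X$, the empty path included$\}\cup\{\top\}$. $\mu$ is a simple measure function if $\mu(v)\in S(v,D_+(\mu))$ for all $v$. $\mu$ is a regress measure if for all $v\in D_+(\mu)\setminus D_0(\mu)$: if $v\in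 V_0$ then $\mu(v)\le\mu(w)+v$ for some $w\in E(v)$; if $v\in V_1$ then $\mu(v)\le\mu(w)+v$ for all $w\in E(v)$. $\mu$ is a quasi-dominion measure if it is a regress measure and $D_0(\mu)$ is a 0-dominion. Lift: $\mathrm{lift}(\mu,S,T)(v)=\max\{\mu(w)+v:w\in E(v)\cap T\}$ if $v\in S\cap V_0$, $\min\{\ldots\}$ if $v\in S\cap V_1$, $\mu(v)$ otherwise. $\mathrm{prg}_\bot(\mu)=\mathrm{lift}(\mu,D_\bot(\mu),V)$. $\mathrm{esc}(\mu,Q)=\{v\in Q\cap V_1:E(v)\setminus Q\neq\emptyset\}\cup\{v\in Q\cap V_0:\forall w\in E(v)\cap Q.\ \mu(w)+v<\mu(v)\}$. $\mathrm{bef}(\mu,Q,v)=\max\{(\mu(w)+v)-\mu(v):w\in E(v)\setminus Q\}$ for $v\in\mathrm{esc}(\mu,Q)\cap V_0$, $\min\{\ldots\}$ for $v\in\mathrm{esc}(\mu,Q)\cap V_1$, and $\top$ (above all evaluations) otherwise. $\mathrm{bep}(\mu,Q)$ = positions of $Q$ of minimal forfeit, contained in $\mathrm{esc}(\mu,Q)$ (empty if the latter is empty). $\mathrm{prg}_+(\mu)$: $Q_0=D_+(\mu)$, $\mu_0=\mu$; $E_i=\mathrm{bep}(\mu_i,Q_i)$, $Q_{i+1}=Q_i\setminus E_i$, $\mu_{i+1}=\mathrm{lift}(\mu_i,E_i,V\setminus Q_i)$; for the least $k$ with $E_k=\emptyset$, $\mathrm{prg}_+(\mu)$ is $\mu_k$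 with every position of $Q_k$ reassigned $\top$. $\mathrm{sol}(\mu)$ is the inflationary fixpoint of $F$ from $\mu$: the value at which $\mu, F(\mu), F^2(\mu),\dots$ becomes stationary. *)

theory Defs
  imports Main "HOL-Library.FuncSet"
begin

section \<open>Parity games\<close>

record 'v game =
  pos0 :: "'v set"
  pos1 :: "'v set"
  moves :: "('v \<times> 'v) set"
  prios :: "nat set"
  prio :: "'v \<Rightarrow> nat"

definition positions :: "'v game \<Rightarrow> 'v set" where
  "positions G = pos0 G \<union> pos1 G"

definition succs :: "'v game \<Rightarrow> 'v \<Rightarrow> 'v set" where
  "succs G v = {w. (v, w) \<in> moves G}"

definition parity_game :: "'v game \<Rightarrow> bool" where
  "parity_game G \<longleftrightarrow>
     finite (pos0 G) \<and> finite (pos1 G) \<and> pos0 G \<inter> pos1 G = {} \<and>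
     moves G \<subseteq> positions G \<times> positions G \<and>
     (\<forall>v \<in> positions G. succs G v \<noteq> {}) \<and>
     finite (prios G) \<and> prio G \<in> positions G \<rightarrow> prios G"

text \<open>
  A strategy is a total HOL function; only its values on the positions of \<open>U\<close> owned by the
  player (the set \<open>A\<close> below is \<open>pos0 G\<close> or \<open>pos1 G\<close>) are constrained, and only those are used
  by plays in \<open>U\<close>.
\<close>

definition strategy_on :: "'v game \<Rightarrow> 'v set \<Rightarrow> 'v set \<Rightarrow> ('v \<Rightarrow> 'v) \<Rightarrow> bool" where
  "strategy_on G A U \<sigma> \<longleftrightarrow> (\<forall>v \<in> U \<inter> A. (v, \<sigma> v) \<in> moves G)"

text \<open>
  The maximal play in \<open>U\<close> as a sequence of optional positions: it is \<open>None\<close> from the moment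
  the prescribed successor lies outside \<open>U\<close>, so the play is infinite iff \<open>None\<close> never occurs.
\<close>

primrec play ::
    "'v game \<Rightarrow> 'v set \<Rightarrow> ('v \<Rightarrow> 'v) \<Rightarrow> ('v \<Rightarrow> 'v) \<Rightarrow> 'v \<Rightarrow> nat \<Rightarrow> 'v option" where
  "play G U \<sigma>0 \<sigma>1 v 0 = (if v \<in> U then Some v else None)"
| "play G U \<sigma>0 \<sigma>1 v (Suc n) =
     (case play G U \<sigma>0 \<sigma>1 v n of
        None \<Rightarrow> None
      | Some u \<Rightarrow> (let w = (if u \<in> pos0 G then \<sigma>0 u else \<sigma>1 u) in if w \<in> U then Some w else None))"

definition play_prio :: "'v game \<Rightarrow> (nat \<Rightarrow> 'v option) \<Rightarrow> nat" where
  "play_prio G \<pi> = Max {k. \<exists>\<^sub>\<infinity>n. map_option (prio G) (\<pi> n) = Some k}"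

definition dominion0 :: "'v game \<Rightarrow> 'v set \<Rightarrow> bool" where
  "dominion0 G U \<longleftrightarrow> U \<subseteq> positions G \<and>
     (\<exists>\<sigma>0. strategy_on G (pos0 G) U \<sigma>0 \<and>
        (\<forall>\<sigma>1. strategy_on G (pos1 G) U \<sigma>1 \<longrightarrow>
           (\<forall>v \<in> U. (\<forall>n. play G U \<sigma>0 \<sigma>1 v n \<noteq> None) \<and>
                    even (play_prio G (play G U \<sigma>0 \<sigma>1 v)))))"


section \<open>Evaluations\<close>

text \<open>
  The type collects the finitely supported functions from priorities to integers, so that the
  alternating order is a linear order on the whole type. The evaluations over a finite set of
  priorities are those vanishing outside it, see \<open>evals\<close> below.
\<close>

typedef evaluation = "{f :: nat \<Rightarrow> int. finite {k. f k \<noteq> 0}}"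
  morphisms ev Abs_evaluation
  by (rule exI[of _ "\<lambda>_. 0"]) simp

setup_lifting type_definition_evaluation

lemma finite_ev_supp [simp]: "finite {k. ev \<eta> k \<noteq> 0}"
  using ev[of \<eta>] by simp

lemma evaluation_eqI: "(\<And>k. ev a k = ev b k) \<Longrightarrow> a = b"
  by (metis ev_inject ext)

lemma finite_ev_diff: "finite {k. ev a k \<noteq> ev b k}"
  by (rule finite_subset[of _ "{k. ev a k \<noteq> 0} \<union> {k. ev b k \<noteq> 0}"]) auto

instantiation evaluation :: ab_group_add
begin

lift_definition zero_evaluation :: evaluation is "\<lambda>_. 0"
  by simp

lift_definition plus_evaluation :: "evaluation \<Rightarrow> evaluation \<Rightarrow> evaluation"
  is "\<lambda>f g k. f k + g k"
  subgoal for f g by (rule finite_subset[of _ "{k. f k \<noteq> 0} \<union> {k. g k \<noteq> 0}"]) auto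
  done

lift_definition minus_evaluation :: "evaluation \<Rightarrow> evaluation \<Rightarrow> evaluation"
  is "\<lambda>f g k. f k - g k"
  subgoal for f g by (rule finite_subset[of _ "{k. f k \<noteq> 0} \<union> {k. g k \<noteq> 0}"]) auto
  done

lift_definition uminus_evaluation :: "evaluation \<Rightarrow> evaluation"
  is "\<lambda>f k. - f k"
  by simp

instance
  by (standard; transfer; auto simp: algebra_simps)

end

instantiation evaluation :: linorder
begin

definition less_evaluation :: "evaluation \<Rightarrow> evaluation \<Rightarrow> bool" where
  "a < b \<longleftrightarrow>
     (\<exists>k. ev a k \<noteq> ev b k \<and> (\<forall>j>k. ev a j = ev b j) \<and>
          (if even k then ev a k < ev b k else ev a k > ev b k))"

definition less_eq_evaluation :: "evaluation \<Rightarrow> evaluation \<Rightarrow> bool" where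
  "a \<le> b \<longleftrightarrow> a < b \<or> a = (b :: evaluation)"

instance
proof
  fix a b c :: evaluation
  have asym: "\<not> b < a" if "a < b" for a b :: evaluation
  proof
    assume "b < a"
    then obtain l where l: "ev b l \<noteq> ev a l" "\<forall>j>l. ev b j = ev a j"
        "if even l then ev b l < ev a l else ev b l > ev a l"
      unfolding less_evaluation_def by blast
    from that obtain k where k: "ev a k \<noteq> ev b k" "\<forall>j>k. ev a j = ev b j"
        "if even k then ev a k < ev b k else ev a k > ev b k"
      unfolding less_evaluation_def by blast
    have "k = l" using k l by (metis linorder_neqE_nat)
    then show False using k l by (auto split: if_splits)
  qed
  have trans: "a < c" if "a < b" "b < c" for a b c :: evaluation
  proof -
    from that(1) obtain k where k: "ev a k \<noteq> ev b k" "\<forall>j>k. ev a j = ev b j"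
        "if even k then ev a k < ev b k else ev a k > ev b k"
      unfolding less_evaluation_def by blast
    from that(2) obtain l where l: "ev b l \<noteq> ev c l" "\<forall>j>l. ev b j = ev c j"
        "if even l then ev b l < ev c l else ev b l > ev c l"
      unfolding less_evaluation_def by blast
    consider "k < l" | "k = l" | "l < k" by linarith
    then show ?thesis
    proof cases
      case 1
      then have "ev a l = ev b l" "\<forall>j>l. ev a j = ev c j" using k(2) l(2) by simp_all
      then show ?thesis using l(1,3) unfolding less_evaluation_def by metis
    next
      case 2
      have "\<forall>j>k. ev a j = ev c j" using k(2) l(2) 2 by simp
      moreover have "if even k then ev a k < ev c k else ev a k > ev c k"
        using k(3) l(3) 2 by (simp split: if_splits)
      moreover from this have "ev a k \<noteq> ev c k" by (simp split: if_splits)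
      ultimately show ?thesis unfolding less_evaluation_def by blast
    next
      case 3
      then have "ev c k = ev b k" "\<forall>j>k. ev a j = ev c j" using k(2) l(2) by simp_all
      then show ?thesis using k(1,3) unfolding less_evaluation_def by metis
    qed
  qed
  show "a < b \<longleftrightarrow> a \<le> b \<and> \<not> b \<le> a"
    using asym[of a b] asym[of a a] unfolding less_eq_evaluation_def by metis
  show "a \<le> a" by (simp add: less_eq_evaluation_def)
  show "a \<le> c" if "a \<le> b" "b \<le> c"
    using that trans[of a b c] unfolding less_eq_evaluation_def by blast
  show "a = b" if "a \<le> b" "b \<le> a"
    using that asym[of a b] unfolding less_eq_evaluation_def by blast
  show "a \<le> b \<or> b \<le> a"
  proof (cases "a = b")
    case False
    define D where "D = {k. ev a k \<noteq> ev b k}"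
    have fin: "finite D" unfolding D_def by (rule finite_ev_diff)
    have ne: "D \<noteq> {}" using False evaluation_eqI unfolding D_def by blast
    define k where "k = Max D"
    have 1: "ev a k \<noteq> ev b k" using Max_in[OF fin ne] by (simp add: k_def D_def)
    have 2: "\<forall>j>k. ev a j = ev b j"
    proof (intro allI impI, rule ccontr)
      fix j assume "k < j" "ev a j \<noteq> ev b j"
      then have "j \<in> D" by (simp add: D_def)
      then have "j \<le> k" using Max_ge[OF fin] by (simp add: k_def)
      with \<open>k < j\<close> show False by simp
    qed
    have "a < b \<or> b < a"
    proof (cases "if even k then ev a k < ev b k else ev a k > ev b k")
      case True
      then show ?thesis using 1 2 unfolding less_evaluation_def by blast
    next
      case False
      then have "if even k then ev b k < ev a k else ev b k > ev a k"
        using 1 by (auto split: if_splits)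
      moreover have "ev b k \<noteq> ev a k" "\<forall>j>k. ev b j = ev a j" using 1 2 by simp_all
      ultimately show ?thesis unfolding less_evaluation_def by blast
    qed
    then show ?thesis by (auto simp: less_eq_evaluation_def)
  qed (simp add: less_eq_evaluation_def)
qed

end

instance evaluation :: linordered_ab_group_add
proof
  fix a b c :: evaluation
  show "a \<le> b \<Longrightarrow> c + a \<le> c + b"
    by (auto simp: less_eq_evaluation_def less_evaluation_def plus_evaluation.rep_eq)
qed

lift_definition delta :: "nat \<Rightarrow> evaluation" is "\<lambda>i j. if j = i then 1 else 0"
  by simp

lift_definition ev_trunc :: "evaluation \<Rightarrow> nat \<Rightarrow> evaluation"
  is "\<lambda>f n k. if n \<le> k then f k else 0"
  subgoal for f n by (rule finite_subset[of _ "{k. f k \<noteq> 0}"]) auto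
  done


section \<open>The concrete measure structure\<close>

text \<open>
  The type adds a greatest element to all evaluations, so it also serves as the codomain of
  forfeits; the measures of a game form the subset \<open>measures G\<close>.
\<close>

datatype meas = Val evaluation | Top

instantiation meas :: linorder
begin

fun less_eq_meas :: "meas \<Rightarrow> meas \<Rightarrow> bool" where
  "Val a \<le> Val b \<longleftrightarrow> a \<le> b"
| "m \<le> Top \<longleftrightarrow> True"
| "Top \<le> Val b \<longleftrightarrow> False"

definition less_meas :: "meas \<Rightarrow> meas \<Rightarrow> bool" where
  "m < m' \<longleftrightarrow> m \<le> m' \<and> \<not> m' \<le> (m :: meas)"

instance
proof
  fix x y z :: meas
  show "x < y \<longleftrightarrow> x \<le> y \<and> \<not> y \<le> x" by (simp add: less_meas_def)
  show "x \<le> x" by (cases x) auto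
  show "x \<le> y \<Longrightarrow> y \<le> z \<Longrightarrow> x \<le> z" by (cases x; cases y; cases z) auto
  show "x \<le> y \<Longrightarrow> y \<le> x \<Longrightarrow> x = y" by (cases x; cases y) auto
  show "x \<le> y \<or> y \<le> x" by (cases x; cases y) auto
qed

end

abbreviation Bot :: meas where
  "Bot \<equiv> Val 0"

definition evals :: "'v game \<Rightarrow> evaluation set" where
  "evals G = {\<eta>. \<forall>k. k \<notin> prios G \<longrightarrow> ev \<eta> k = 0}"

definition pos_evals :: "'v game \<Rightarrow> evaluation set" where
  "pos_evals G =
     {\<eta> \<in> evals G. (\<forall>k. 0 \<le> ev \<eta> k) \<and> (\<eta> = 0 \<or> even (Max {k. ev \<eta> k \<noteq> 0}))}"

definition measures :: "'v game \<Rightarrow> meas set" where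
  "measures G = Val ` pos_evals G \<union> {Top}"

fun trunc :: "'v game \<Rightarrow> meas \<Rightarrow> 'v \<Rightarrow> meas" where
  "trunc G Top v = Top"
| "trunc G (Val \<eta>) v = Val (ev_trunc \<eta> (prio G v))"

fun stretch :: "'v game \<Rightarrow> meas \<Rightarrow> 'v \<Rightarrow> meas" where
  "stretch G Top v = Top"
| "stretch G (Val \<eta>) v = max Bot (Val (\<eta> + delta (prio G v)))"

text \<open>
  Differences are only meaningful between evaluations. Those involving \<open>Top\<close> are left
  unspecified; they do not arise when the operators below are run on elements of \<open>SQDMF\<close>.
\<close>

fun mdiff :: "meas \<Rightarrow> meas \<Rightarrow> meas" where
  "mdiff (Val a) (Val b) = Val (a - b)"
| "mdiff _ _ = undefined"


section \<open>Measure functions\<close>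

text \<open>
  Measure functions are extensional (\<open>undefined\<close> outside the positions), so that HOL equality
  is equality of functions on the positions.
\<close>

definition MF :: "'v game \<Rightarrow> ('v \<Rightarrow> meas) set" where
  "MF G = positions G \<rightarrow>\<^sub>E measures G"

definition MF_le :: "'v game \<Rightarrow> ('v \<Rightarrow> meas) \<Rightarrow> ('v \<Rightarrow> meas) \<Rightarrow> bool" where
  "MF_le G \<mu> \<nu> \<longleftrightarrow> (\<forall>v \<in> positions G. \<mu> v \<le> \<nu> v)"

definition D_zero :: "'v game \<Rightarrow> ('v \<Rightarrow> meas) \<Rightarrow> 'v set" where
  "D_zero G \<mu> = {v \<in> positions G. trunc G (\<mu> v) v = Top}"

definition D_bot :: "'v game \<Rightarrow> ('v \<Rightarrow> meas) \<Rightarrow> 'v set" where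
  "D_bot G \<mu> = {v \<in> positions G. trunc G (\<mu> v) v = Bot}"

definition D_plus :: "'v game \<Rightarrow> ('v \<Rightarrow> meas) \<Rightarrow> 'v set" where
  "D_plus G \<mu> = positions G - D_bot G \<mu>"

primrec msr :: "'v game \<Rightarrow> 'v list \<Rightarrow> meas" where
  "msr G [] = Bot"
| "msr G (v # \<pi>) = stretch G (msr G \<pi>) v"

definition simple_paths :: "'v game \<Rightarrow> 'v \<Rightarrow> 'v set \<Rightarrow> 'v list set" where
  "simple_paths G v X =
     {\<pi>. (\<pi> = [] \<or> hd \<pi> = v) \<and> successively (\<lambda>u w. (u, w) \<in> moves G) \<pi> \<and>
         distinct \<pi> \<and> set \<pi> \<subseteq> X}"

definition simple_measures :: "'v game \<Rightarrow> 'v \<Rightarrow> 'v set \<Rightarrow> meas set" where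
  "simple_measures G v X = msr G ` simple_paths G v X \<union> {Top}"

definition SMF :: "'v game \<Rightarrow> ('v \<Rightarrow> meas) set" where
  "SMF G = {\<mu> \<in> MF G. \<forall>v \<in> positions G. \<mu> v \<in> simple_measures G v (D_plus G \<mu>)}"

definition regress_measure :: "'v game \<Rightarrow> ('v \<Rightarrow> meas) \<Rightarrow> bool" where
  "regress_measure G \<mu> \<longleftrightarrow>
     (\<forall>v \<in> D_plus G \<mu> - D_zero G \<mu>.
        (v \<in> pos0 G \<longrightarrow> (\<exists>w \<in> succs G v. \<mu> v \<le> stretch G (\<mu> w) v)) \<and>
        (v \<in> pos1 G \<longrightarrow> (\<forall>w \<in> succs G v. \<mu> v \<le> stretch G (\<mu> w) v)))"

definition quasi_dominion_measure :: "'v game \<Rightarrow> ('v \<Rightarrow> meas) \<Rightarrow> bool" where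
  "quasi_dominion_measure G \<mu> \<longleftrightarrow> regress_measure G \<mu> \<and> dominion0 G (D_zero G \<mu>)"

definition SQDMF :: "'v game \<Rightarrow> ('v \<Rightarrow> meas) set" where
  "SQDMF G = {\<mu> \<in> SMF G. quasi_dominion_measure G \<mu>}"

lemma finite_SMF:
  fixes G :: "'v game"
  assumes "parity_game G"
  shows "finite (SMF G)"
proof -
  have fin: "finite (positions G)"
    using assms by (simp add: parity_game_def positions_def)
  define A where "A = msr G ` {\<pi>. distinct \<pi> \<and> set \<pi> \<subseteq> positions G} \<union> {Top}"
  have "finite {\<pi>. set \<pi> \<subseteq> positions G \<and> length \<pi> \<le> card (positions G)}"
    by (rule finite_lists_length_le[OF fin])
  moreover have "{\<pi>. distinct \<pi> \<and> set \<pi> \<subseteq> positions G}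
      \<subseteq> {\<pi>. set \<pi> \<subseteq> positions G \<and> length \<pi> \<le> card (positions G)}"
  proof (rule subsetI)
    fix \<pi> :: "'v list" assume "\<pi> \<in> {\<pi>. distinct \<pi> \<and> set \<pi> \<subseteq> positions G}"
    then have d: "distinct \<pi>" and sub: "set \<pi> \<subseteq> positions G" by blast+
    have "length \<pi> \<le> card (positions G)"
      using card_mono[OF fin sub] distinct_card[OF d] by simp
    with sub show "\<pi> \<in> {\<pi>. set \<pi> \<subseteq> positions G \<and> length \<pi> \<le> card (positions G)}" by blast
  qed
  ultimately have "finite {\<pi>. distinct \<pi> \<and> set \<pi> \<subseteq> positions G}"
    by (rule finite_subset[rotated])
  then have "finite A"
    unfolding A_def by (intro finite_UnI finite_imageI) simp_all
  then have "finite (positions G \<rightarrow>\<^sub>E A)"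
    using fin by (rule finite_PiE[rotated])
  moreover have "SMF G \<subseteq> positions G \<rightarrow>\<^sub>E A"
  proof
    fix \<mu> assume mu: "\<mu> \<in> SMF G"
    show "\<mu> \<in> positions G \<rightarrow>\<^sub>E A"
    proof (rule PiE_I)
      fix v assume "v \<in> positions G"
      then have "\<mu> v \<in> simple_measures G v (D_plus G \<mu>)"
        using mu by (simp add: SMF_def)
      then show "\<mu> v \<in> A"
        unfolding A_def simple_measures_def simple_paths_def D_plus_def by auto
    next
      fix v assume "v \<notin> positions G"
      then show "\<mu> v = undefined" using mu by (auto simp: SMF_def MF_def)
    qed
  qed
  ultimately show ?thesis by (rule finite_subset[rotated])
qed

text \<open>
  The maximal cardinality of a totally ordered subset, for a finite partial order on \<open>A\<close>.
\<close>

definition depth :: "'a set \<Rightarrow> ('a \<Rightarrow> 'a \<Rightarrow> bool) \<Rightarrow> nat" where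
  "depth A le = Max {card C | C. C \<subseteq> A \<and> Complete_Partial_Order.chain le C}"


section \<open>The progress operators and the solver\<close>

text \<open>
  Maxima and minima of empty sets are unspecified; they do not arise on elements of \<open>SQDMF\<close>.
\<close>

definition lift :: "'v game \<Rightarrow> ('v \<Rightarrow> meas) \<Rightarrow> 'v set \<Rightarrow> 'v set \<Rightarrow> 'v \<Rightarrow> meas" where
  "lift G \<mu> S T = (\<lambda>v.
     if v \<in> S \<inter> pos0 G then Max {stretch G (\<mu> w) v | w. w \<in> succs G v \<inter> T}
     else if v \<in> S \<inter> pos1 G then Min {stretch G (\<mu> w) v | w. w \<in> succs G v \<inter> T}
     else \<mu> v)"

definition prg_bot :: "'v game \<Rightarrow> ('v \<Rightarrow> meas) \<Rightarrow> 'v \<Rightarrow> meas" where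
  "prg_bot G \<mu> = lift G \<mu> (D_bot G \<mu>) (positions G)"

definition esc :: "'v game \<Rightarrow> ('v \<Rightarrow> meas) \<Rightarrow> 'v set \<Rightarrow> 'v set" where
  "esc G \<mu> Q =
     {v \<in> Q \<inter> pos1 G. succs G v - Q \<noteq> {}} \<union>
     {v \<in> Q \<inter> pos0 G. \<forall>w \<in> succs G v \<inter> Q. stretch G (\<mu> w) v < \<mu> v}"

definition bef :: "'v game \<Rightarrow> ('v \<Rightarrow> meas) \<Rightarrow> 'v set \<Rightarrow> 'v \<Rightarrow> meas" where
  "bef G \<mu> Q v =
     (if v \<in> esc G \<mu> Q \<inter> pos0 G
        then Max {mdiff (stretch G (\<mu> w) v) (\<mu> v) | w. w \<in> succs G v - Q}
      else if v \<in> esc G \<mu> Q \<inter> pos1 G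
        then Min {mdiff (stretch G (\<mu> w) v) (\<mu> v) | w. w \<in> succs G v - Q}
      else Top)"

definition bep :: "'v game \<Rightarrow> ('v \<Rightarrow> meas) \<Rightarrow> 'v set \<Rightarrow> 'v set" where
  "bep G \<mu> Q = {v \<in> esc G \<mu> Q. \<forall>u \<in> Q. bef G \<mu> Q v \<le> bef G \<mu> Q u}"

text \<open>The pair after \<open>i\<close> steps consists of the \<open>i\<close>-th measure function and the \<open>i\<close>-th set.\<close>

primrec prg_plus_seq :: "'v game \<Rightarrow> ('v \<Rightarrow> meas) \<Rightarrow> nat \<Rightarrow> ('v \<Rightarrow> meas) \<times> 'v set" where
  "prg_plus_seq G \<mu> 0 = (\<mu>, D_plus G \<mu>)"
| "prg_plus_seq G \<mu> (Suc i) =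
     (let (\<mu>\<^sub>i, Q\<^sub>i) = prg_plus_seq G \<mu> i; E\<^sub>i = bep G \<mu>\<^sub>i Q\<^sub>i
      in (lift G \<mu>\<^sub>i E\<^sub>i (positions G - Q\<^sub>i), Q\<^sub>i - E\<^sub>i))"

definition prg_plus :: "'v game \<Rightarrow> ('v \<Rightarrow> meas) \<Rightarrow> 'v \<Rightarrow> meas" where
  "prg_plus G \<mu> =
     (let k = (LEAST k. case prg_plus_seq G \<mu> k of (\<mu>\<^sub>k, Q\<^sub>k) \<Rightarrow> bep G \<mu>\<^sub>k Q\<^sub>k = {});
          (\<mu>\<^sub>k, Q\<^sub>k) = prg_plus_seq G \<mu> k
      in (\<lambda>v. if v \<in> Q\<^sub>k then Top else \<mu>\<^sub>k v))"

definition solver_step :: "'v game \<Rightarrow> ('v \<Rightarrow> meas) \<Rightarrow> 'v \<Rightarrow> meas" where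
  "solver_step G = prg_plus G \<circ> prg_bot G"

definition stationary_value :: "('a \<Rightarrow> 'a) \<Rightarrow> 'a \<Rightarrow> 'a \<Rightarrow> bool" where
  "stationary_value f x y \<longleftrightarrow> (\<exists>k. \<forall>n\<ge>k. (f ^^ n) x = y)"

definition sol :: "'v game \<Rightarrow> ('v \<Rightarrow> meas) \<Rightarrow> 'v \<Rightarrow> meas" where
  "sol G \<mu> = (THE \<nu>. stationary_value (solver_step G) \<mu> \<nu>)"

end

(*
  On a simple measure function the positions in D_bot are exactly those of measure Bot. The operator
  prg_bot raises these by one stretch, which adds to the 0-dominion of Top positions at most a
  one-step attractor. The operator prg_plus lets the positions of D_plus escape in the order of their
  forfeits; as the forfeits never decrease along the iteration, the raised values still satisfy the
  regress inequalities. On the positions that never escape the measure is a potential: it drops along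
  every play by at most the priorities seen, so the dominating priority is even and they form a
  0-dominion. Hence both operators preserve SQDMF and are inflationary, and the iterates of their
  composition form a strict chain of simple measure functions until they become stationary.
*)

theory Submission
  imports Defs "HOL-Library.Infinite_Set"
begin

section \<open>Evaluations and measures\<close>

text \<open>Two obstacles shape the proof. The cut-off at \<open>Bot\<close> keeps
  \<open>stretch\<close> from being additive, but a regress inequality at a position of measure
  above \<open>Bot\<close> is a genuine inequality between evaluations and may be translated. The
  positions leaving in one round share the minimal forfeit \<open>g\<close> and rise by exactly
  \<open>g\<close>; by translation, a predecessor that afterwards reads one of them has forfeit at
  least \<open>g\<close>, while values read from positions that left earlier are covered by the
  minimality of \<open>g\<close>. This is why forfeits never decrease. Simplicity of paths survives
  because every lift reads a value whose witnessing path lies in a set that the lifted position has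
  not yet entered. Differences and extrema are unspecified in the awkward cases (\<open>Top\<close>,
  empty sets), so the escape iteration must also be shown to avoid these: positions of measure
  \<open>Top\<close> never escape, because they form a 0-dominion.\<close>

lemma ev_plus [simp]: "ev (a + b) k = ev a k + ev b k"
  by (simp add: plus_evaluation.rep_eq)

lemma ev_zero [simp]: "ev 0 k = 0"
  by (simp add: zero_evaluation.rep_eq)

lemma ev_delta: "ev (delta i) k = (if k = i then 1 else 0)"
  by (simp add: delta.rep_eq)

lemma ev_trunc_nth: "ev (ev_trunc a n) k = (if n \<le> k then ev a k else 0)"
  by (simp add: ev_trunc.rep_eq)

lemma ev_sum: "ev (sum f A) k = (\<Sum>i\<in>A. ev (f i) k)"
  by (induction A rule: infinite_finite_induct) auto

lemma meas_le_Top [simp]: "m \<le> Top"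
  by (cases m) auto

lemma Top_le_iff [simp]: "Top \<le> m \<longleftrightarrow> m = Top"
  by (cases m) auto

lemma mdiff_mono: "m \<le> m' \<Longrightarrow> m' \<noteq> Top \<Longrightarrow> mdiff m (Val a) \<le> mdiff m' (Val a)"
  by (cases m; cases m') auto

lemma stretch_mono: "m \<le> m' \<Longrightarrow> stretch G m v \<le> stretch G m' v"
proof (cases m'; cases m)
  fix a b assume "m \<le> m'" "m' = Val a" "m = Val b"
  then show ?thesis using max.mono[of Bot Bot "Val (b + delta (prio G v))"] by simp
qed auto

lemma stretch_ge_Bot [simp]: "Bot \<le> stretch G m v"
  by (cases m) auto

lemma stretch_eq_Top_iff [simp]: "stretch G m v = Top \<longleftrightarrow> m = Top"
  by (cases m) (auto simp: max_def)

text \<open>Above \<open>Bot\<close> the cut-off in the definition of stretch is not effective.\<close>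

lemma le_stretchD:
  assumes "Val a \<le> stretch G (Val b) v" "Val a \<noteq> Bot" "Bot \<le> Val a"
  shows "a \<le> b + delta (prio G v)"
  using assms by (auto simp: max_def split: if_splits)

lemma measures_Bot [simp]: "Bot \<in> measures G" and measures_Top [simp]: "Top \<in> measures G"
  by (auto simp: measures_def pos_evals_def evals_def)

text \<open>If all entries are nonnegative and the greatest nonzero priority is odd, the evaluation
  is below 0 in the alternating order. So the cut-off catches exactly the sums that would not be
  measures.\<close>

lemma stretch_measures:
  assumes G: "parity_game G" and v: "v \<in> positions G" and m: "m \<in> measures G"
  shows "stretch G m v \<in> measures G"
proof (cases m)
  case (Val a)
  let ?p = "prio G v"
  let ?b = "a + delta ?p"
  have p: "?p \<in> prios G" using G v by (auto simp: parity_game_def)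
  from m Val have a: "a \<in> evals G" "\<And>k. 0 \<le> ev a k" "a = 0 \<or> even (Max {k. ev a k \<noteq> 0})"
    by (auto simp: measures_def pos_evals_def)
  have b: "?b \<in> evals G" "\<And>k. 0 \<le> ev ?b k"
    using a p by (auto simp: evals_def ev_delta)
  have bp: "0 < ev ?b ?p" using a(2)[of ?p] by (simp add: ev_delta)
  show ?thesis
  proof (cases "0 \<le> ?b")
    case True
    define k where "k = Max {k. ev ?b k \<noteq> 0}"
    have fin: "finite {k. ev ?b k \<noteq> 0}" by (rule finite_ev_supp)
    have "{k. ev ?b k \<noteq> 0} \<noteq> {}" 
    proof
      assume "{k. ev ?b k \<noteq> 0} = {}"
      then have "ev ?b ?p = 0" by blast
      with bp show False by simp
    qed
    from Max_in[OF fin this] have k: "ev ?b k \<noteq> 0" unfolding k_def by blast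
    have above: "j \<le> k" if "ev ?b j \<noteq> 0" for j
      using Max_ge[OF fin] that unfolding k_def by blast
    have "even k"
    proof (rule ccontr)
      assume "odd k"
      moreover have "0 < ev ?b k" using k b(2)[of k] by simp
      ultimately have "?b < 0"
        using above k unfolding less_evaluation_def
        by (intro exI[of _ k]) (auto simp: not_le[symmetric])
      with True show False by simp
    qed
    then have "?b \<in> pos_evals G" using b unfolding pos_evals_def k_def by blast
    moreover have "stretch G m v = Val ?b" using Val True by (simp add: max_def)
    ultimately show ?thesis by (simp add: measures_def)
  next
    case False
    then have "stretch G m v = Bot" using Val by (simp add: max_def)
    then show ?thesis by simp
  qed
qed simp

text \<open>The unit added by the stretch sits at \<open>prio G v\<close> itself, on top of a
  nonnegative entry, and this entry survives truncation at \<open>v\<close>.\<close>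

lemma trunc_stretch:
  assumes m: "m \<in> measures G" and ne: "stretch G m v \<noteq> Bot"
  shows "trunc G (stretch G m v) v \<noteq> Bot"
proof (cases m)
  case (Val a)
  have "0 \<le> ev a (prio G v)"
    using m Val by (auto simp: measures_def pos_evals_def)
  then have "0 < ev (ev_trunc (a + delta (prio G v)) (prio G v)) (prio G v)"
    by (simp add: ev_trunc_nth ev_delta)
  then have "ev_trunc (a + delta (prio G v)) (prio G v) \<noteq> 0" by force
  then show ?thesis using Val ne by (auto simp: max_def)
qed simp

lemma trunc_Bot [simp]: "trunc G Bot v = Bot"
  by (auto intro!: evaluation_eqI simp: ev_trunc_nth)

lemma trunc_eq_Top_iff [simp]: "trunc G m v = Top \<longleftrightarrow> m = Top"
  by (cases m) auto

lemma D_zero_eq: "D_zero G \<mu> = {v \<in> positions G. \<mu> v = Top}"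
  by (simp add: D_zero_def)

section \<open>Simple measures and the positions of measure \<open>Bot\<close>\<close>

lemma msr_measures: "parity_game G \<Longrightarrow> set \<pi> \<subseteq> positions G \<Longrightarrow> msr G \<pi> \<in> measures G"
  by (induction \<pi>) (auto intro: stretch_measures)

lemma simple_measuresE:
  assumes "m \<in> simple_measures G v X"
  obtains "m = Bot" | "m = Top"
    | \<pi> where "v # \<pi> \<in> simple_paths G v X" "m = stretch G (msr G \<pi>) v"
proof -
  consider "m = Top" | \<pi> where "\<pi> \<in> simple_paths G v X" "m = msr G \<pi>"
    using assms by (auto simp: simple_measures_def)
  then show ?thesis
  proof cases
    case 2
    show ?thesis
    proof (cases \<pi>)
      case (Cons u \<rho>)
      with 2 have "u = v" by (simp add: simple_paths_def)
      with 2 Cons that(3) show ?thesis by simp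
    qed (use 2 that in auto)
  qed (use that in auto)
qed

lemma Bot_simple [simp]: "Bot \<in> simple_measures G v X"
  by (auto simp: simple_measures_def simple_paths_def intro!: image_eqI[of _ _ "[]"])

lemma Top_simple [simp]: "Top \<in> simple_measures G v X"
  by (simp add: simple_measures_def)

lemma simple_measures_mono: "X \<subseteq> Y \<Longrightarrow> simple_measures G v X \<subseteq> simple_measures G v Y"
  by (fastforce simp: simple_measures_def simple_paths_def)

lemma simple_measures_ge_Bot: "m \<in> simple_measures G v X \<Longrightarrow> Bot \<le> m"
  by (erule simple_measuresE) auto

text \<open>Prefixing \<open>v\<close> keeps a path simple because \<open>v\<close> lies outside
  \<open>X\<close>, which holds the rest of the path. Both progress operators lift a position from
  values witnessed in such a set.\<close>

lemma stretch_simple_measures: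
  assumes "m \<in> simple_measures G w X" "w \<in> succs G v" "v \<notin> X" "insert v X \<subseteq> Y"
  shows "stretch G m v \<in> simple_measures G v Y"
proof -
  have ext: "stretch G (msr G \<pi>) v \<in> simple_measures G v Y"
    if "\<pi> \<in> simple_paths G w X" for \<pi>
  proof -
    have "v # \<pi> \<in> simple_paths G v Y"
      using that assms(2-4) by (cases \<pi>) (auto simp: simple_paths_def succs_def)
    then have "msr G (v # \<pi>) \<in> simple_measures G v Y"
      unfolding simple_measures_def by blast
    then show ?thesis by simp
  qed
  show ?thesis
    using assms(1) ext by (auto simp: simple_measures_def[of _ w])
qed

text \<open>\<open>SMF\<close> is self-referential: the paths must lie in
  \<open>D_plus G \<mu>\<close>, the set to be computed. A free \<open>X\<close> lets
  \<open>SMF_iff\<close> instantiate it by that set in one direction and by the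
  non-\<open>Bot\<close> positions in the other.\<close>

lemma D_plus_simple:
  assumes G: "parity_game G" and X: "X \<subseteq> positions G"
    and simple: "\<And>v. v \<in> positions G \<Longrightarrow> \<mu> v \<in> simple_measures G v X"
  shows "D_plus G \<mu> = {v \<in> positions G. \<mu> v \<noteq> Bot}"
proof -
  have "trunc G (\<mu> v) v \<noteq> Bot" if v: "v \<in> positions G" "\<mu> v \<noteq> Bot" for v
    using simple[OF v(1)]
  proof (cases rule: simple_measuresE)
    case (3 \<pi>)
    then have "msr G \<pi> \<in> measures G"
      using X by (intro msr_measures[OF G]) (auto simp: simple_paths_def)
    with 3 v show ?thesis using trunc_stretch by metis
  qed (use v in auto)
  moreover have "\<mu> v \<noteq> Bot" if "trunc G (\<mu> v) v \<noteq> Bot" for v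
    using that trunc_Bot[of G v] by metis
  ultimately show ?thesis unfolding D_plus_def D_bot_def by blast
qed

lemma SMF_iff:
  assumes G: "parity_game G"
  shows "\<mu> \<in> SMF G \<longleftrightarrow> \<mu> \<in> MF G \<and>
    (\<forall>v \<in> positions G. \<mu> v \<in> simple_measures G v {v \<in> positions G. \<mu> v \<noteq> Bot})"
    (is "_ \<longleftrightarrow> _ \<and> (\<forall>v \<in> _. _ \<in> simple_measures _ _ ?X)")
proof
  assume "\<mu> \<in> SMF G"
  moreover from this have "D_plus G \<mu> = ?X"
    by (intro D_plus_simple[OF G, of "D_plus G \<mu>"]) (auto simp: SMF_def D_plus_def)
  ultimately show "\<mu> \<in> MF G \<and> (\<forall>v \<in> positions G. \<mu> v \<in> simple_measures G v ?X)"
    by (simp add: SMF_def)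
next
  assume R: "\<mu> \<in> MF G \<and> (\<forall>v \<in> positions G. \<mu> v \<in> simple_measures G v ?X)"
  then have "D_plus G \<mu> = ?X"
    by (intro D_plus_simple[OF G, of ?X]) auto
  with R show "\<mu> \<in> SMF G" by (simp add: SMF_def)
qed

lemma SMF_D_plus: "parity_game G \<Longrightarrow> \<mu> \<in> SMF G \<Longrightarrow> D_plus G \<mu> = {v \<in> positions G. \<mu> v \<noteq> Bot}"
  by (rule D_plus_simple[of _ "D_plus G \<mu>"]) (auto simp: SMF_def D_plus_def)

lemma SMF_D_bot: "parity_game G \<Longrightarrow> \<mu> \<in> SMF G \<Longrightarrow> D_bot G \<mu> = {v \<in> positions G. \<mu> v = Bot}"
  using SMF_D_plus[of G \<mu>] unfolding D_plus_def by (auto simp: D_bot_def)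

section \<open>Dominions\<close>

text \<open>The successor map of \<open>play\<close> without the test for leaving the set, so that
  plays that never leave are plain iterates and can be compared across different sets.\<close>

definition step :: "'v game \<Rightarrow> ('v \<Rightarrow> 'v) \<Rightarrow> ('v \<Rightarrow> 'v) \<Rightarrow> 'v \<Rightarrow> 'v" where
  "step G \<sigma>0 \<sigma>1 u = (if u \<in> pos0 G then \<sigma>0 u else \<sigma>1 u)"

lemma play_closed:
  assumes "\<And>u. u \<in> U \<Longrightarrow> step G \<sigma>0 \<sigma>1 u \<in> U" "v \<in> U"
  shows "(step G \<sigma>0 \<sigma>1 ^^ n) v \<in> U \<and> play G U \<sigma>0 \<sigma>1 v n = Some ((step G \<sigma>0 \<sigma>1 ^^ n) v)"
proof (induction n)
  case (Suc n)
  let ?u = "(step G \<sigma>0 \<sigma>1 ^^ n) v"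
  from Suc have "step G \<sigma>0 \<sigma>1 ?u \<in> U" using assms(1) by blast
  moreover from this Suc have "play G U \<sigma>0 \<sigma>1 v (Suc n) = Some (step G \<sigma>0 \<sigma>1 ?u)"
    by (simp add: step_def[of _ _ _ ?u] Let_def split del: if_split)
  ultimately show ?case by (simp del: play.simps)
qed (use assms in simp)

lemma play_prio_shift: "play_prio G (\<lambda>n. \<pi> (n + N)) = play_prio G \<pi>"
proof -
  have "(\<exists>\<^sub>\<infinity>n. P (n + N)) \<longleftrightarrow> (\<exists>\<^sub>\<infinity>n. P n)" for P :: "nat \<Rightarrow> bool"
    using eventually_sequentially_seg[of "\<lambda>n. \<not> P n" N]
    by (simp add: cofinite_eq_sequentially frequently_def)
  from this[of "\<lambda>n. map_option (prio G) (\<pi> n) = Some _"] show ?thesis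
    by (simp add: play_prio_def)
qed

text \<open>
  Summing the inequalities between two visits of a position with the dominating priority, the
  potentials cancel, so the priorities seen in between sum up to a nonnegative evaluation.
\<close>

lemma potential_even:
  assumes fin: "finite A" and s: "\<And>n. s n \<in> A"
    and pot: "\<And>n. h (s n) \<le> h (s (Suc n)) + delta (prio G (s n))"
  shows "even (play_prio G (\<lambda>n. Some (s n)))"
proof -
  define K where "K = {k. \<exists>\<^sub>\<infinity>n. prio G (s n) = k}"
  define k where "k = Max K"
  have K_sub: "K \<subseteq> prio G ` A"
    using s by (auto simp: K_def dest: frequently_ex)
  then have finK: "finite K" using fin finite_subset by blast
  have "\<exists>\<^sub>\<infinity>n. \<exists>u \<in> A. prio G (s n) = prio G u"
    using s by (auto simp: INFM_nat)
  from frequently_bex_finite[OF fin this]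
  obtain u0 where "\<exists>\<^sub>\<infinity>n. prio G (s n) = prio G u0" ..
  then have "K \<noteq> {}" by (auto simp: K_def)
  then have "k \<in> K" using Max_in[OF finK] by (simp add: k_def)
  \<comment> \<open>Pigeonhole on the finite set \<open>A\<close>: not only the priority
    \<open>k\<close> but one fixed position carrying it recurs forever, so that equal potentials can
    cancel.\<close>
  then have "\<exists>\<^sub>\<infinity>n. \<exists>u \<in> A. s n = u \<and> prio G u = k"
    using s by (auto simp: K_def)
  from frequently_bex_finite[OF fin this]
  obtain u where inf: "\<exists>\<^sub>\<infinity>n. s n = u \<and> prio G u = k" ..
  have inf_u: "\<exists>\<^sub>\<infinity>n. s n = u" using inf by (rule frequently_elim1) simp
  have u: "prio G u = k" using frequently_ex[OF inf] by simp
  \<comment> \<open>Only finitely many priorities on \<open>A\<close> exceed \<open>k\<close> and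
    none of them recurs forever, so from one common \<open>N\<close> on none occurs.\<close>
  have "\<forall>j \<in> {j \<in> prio G ` A. k < j}. \<forall>\<^sub>\<infinity>n. prio G (s n) \<noteq> j"
  proof
    fix j assume "j \<in> {j \<in> prio G ` A. k < j}"
    then have "j \<notin> K" using Max_ge[OF finK, of j] by (auto simp: k_def)
    then show "\<forall>\<^sub>\<infinity>n. prio G (s n) \<noteq> j" by (simp add: K_def not_INFM)
  qed
  then have "\<forall>\<^sub>\<infinity>n. \<forall>j \<in> {j \<in> prio G ` A. k < j}. prio G (s n) \<noteq> j"
    using fin by (intro eventually_ball_finite) auto
  then obtain N where N: "\<And>n. N \<le> n \<Longrightarrow> \<forall>j \<in> {j \<in> prio G ` A. k < j}. prio G (s n) \<noteq> j"
    by (auto simp: MOST_nat_le)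
  have N': "prio G (s n) \<le> k" if "N \<le> n" for n
    using N[OF that] s[of n] by (auto simp: not_less[symmetric])
  obtain m where m: "N \<le> m" "s m = u" using inf_u by (auto simp: INFM_nat_le)
  \<comment> \<open>The second visit is strictly later, so the interval contains \<open>m\<close>
    itself and entry \<open>k\<close> of the sum is positive.\<close>
  obtain m' where m': "Suc m \<le> m'" "s m' = u" using inf_u unfolding INFM_nat_le by blast
  define T where "T = (\<Sum>i = m..<m'. delta (prio G (s i)))"
  have "h (s m) \<le> h (s (m + n)) + (\<Sum>i = m..<m + n. delta (prio G (s i)))" for n
  proof (induction n)
    case (Suc n)
    have "h (s (m + n)) + (\<Sum>i = m..<m + n. delta (prio G (s i)))
        \<le> (h (s (Suc (m + n))) + delta (prio G (s (m + n)))) + (\<Sum>i = m..<m + n. delta (prio G (s i)))"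
      using pot by (rule add_right_mono)
    with Suc have "h (s m) \<le> h (s (Suc (m + n))) + delta (prio G (s (m + n)))
        + (\<Sum>i = m..<m + n. delta (prio G (s i)))" by (rule order_trans)
    then show ?case by (simp add: add.assoc add.commute[of "delta _"])
  qed simp
  from this[of "m' - m"] have T: "0 \<le> T" using m m' by (simp add: T_def)
  have above: "ev T j = 0" if "k < j" for j
    unfolding T_def ev_sum
  proof (intro sum.neutral ballI)
    fix i assume "i \<in> {m..<m'}"
    then have "prio G (s i) < j" using N'[of i] m that by simp
    then show "ev (delta (prio G (s i))) j = 0" by (simp add: ev_delta)
  qed
  have pos: "0 < ev T k"
    unfolding T_def ev_sum using m m' u
    by (intro sum_pos2[of _ m]) (auto simp: ev_delta)
  have "even k"
  proof (rule ccontr)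
    assume "odd k"
    then have "T < 0" using above pos unfolding less_evaluation_def by (intro exI[of _ k]) auto
    with T show False by simp
  qed
  then show ?thesis by (simp add: play_prio_def k_def K_def)
qed

text \<open>Player 0 follows the given strategy inside \<open>D\<close> and the moves granted by
  assumption \<open>pos0\<close> outside. A play that ever meets \<open>D\<close> continues as a
  play of \<open>D\<close>, and the finite prefix does not affect its priority; a play that avoids
  \<open>D\<close> satisfies the potential inequality at every move.\<close>

lemma dominion_extend:
  assumes G: "parity_game G" and D: "dominion0 G D" and DU: "D \<subseteq> U" and U: "U \<subseteq> positions G"
    and pos0: "\<And>v. v \<in> U - D \<Longrightarrow> v \<in> pos0 G \<Longrightarrow>
      \<exists>w \<in> succs G v \<inter> U. w \<in> D \<or> h v \<le> h w + delta (prio G v)"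
    and pos1: "\<And>v w. v \<in> U - D \<Longrightarrow> v \<in> pos1 G \<Longrightarrow> w \<in> succs G v \<Longrightarrow>
      w \<in> U \<and> (w \<in> D \<or> h v \<le> h w + delta (prio G v))"
  shows "dominion0 G U"
proof -
  from D obtain \<sigma> where \<sigma>: "strategy_on G (pos0 G) D \<sigma>"
    and win: "\<And>\<sigma>1 v. strategy_on G (pos1 G) D \<sigma>1 \<Longrightarrow> v \<in> D \<Longrightarrow>
      (\<forall>n. play G D \<sigma> \<sigma>1 v n \<noteq> None) \<and> even (play_prio G (play G D \<sigma> \<sigma>1 v))"
    unfolding dominion0_def by blast
  from pos0 obtain \<rho> where \<rho>: "\<And>v. v \<in> U - D \<Longrightarrow> v \<in> pos0 G \<Longrightarrow>
      \<rho> v \<in> succs G v \<and> \<rho> v \<in> U \<and> (\<rho> v \<in> D \<or> h v \<le> h (\<rho> v) + delta (prio G v))"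
    by (metis IntE)
  define \<tau> where "\<tau> v = (if v \<in> D then \<sigma> v else \<rho> v)" for v
  have \<tau>: "strategy_on G (pos0 G) U \<tau>"
    using \<sigma> \<rho> by (auto simp: strategy_on_def \<tau>_def succs_def)
  have "(\<forall>n. play G U \<tau> \<sigma>1 v n \<noteq> None) \<and> even (play_prio G (play G U \<tau> \<sigma>1 v))"
    if \<sigma>1: "strategy_on G (pos1 G) U \<sigma>1" and v: "v \<in> U" for \<sigma>1 v
  proof -
    let ?f = "step G \<tau> \<sigma>1"
    have \<sigma>1D: "strategy_on G (pos1 G) D \<sigma>1" using \<sigma>1 DU by (auto simp: strategy_on_def)
    have step_D: "step G \<sigma> \<sigma>1 u = ?f u" if "u \<in> D" for u
      using that by (simp add: step_def \<tau>_def)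
    \<comment> \<open>Leaving \<open>D\<close> from \<open>u\<close> would end the play at once, so
      the winning condition is instantiated at index 1.\<close>
    have closed_D: "?f u \<in> D" if u: "u \<in> D" for u
      using win[OF \<sigma>1D u] u spec[of "\<lambda>n. play G D \<sigma> \<sigma>1 u n \<noteq> None" 1]
      by (auto simp: step_def \<tau>_def Let_def split: if_splits)
    have outside: "?f u \<in> U \<and> (?f u \<in> D \<or> h u \<le> h (?f u) + delta (prio G u))"
      if u: "u \<in> U - D" for u
    proof (cases "u \<in> pos0 G")
      case True
      then show ?thesis using \<rho> u by (simp add: step_def \<tau>_def)
    next
      case False
      then have "u \<in> pos1 G" using u U by (auto simp: positions_def)
      moreover from this have "\<sigma>1 u \<in> succs G u"
        using u \<sigma>1 by (simp add: strategy_on_def succs_def)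
      ultimately show ?thesis using pos1 u False by (simp add: step_def)
    qed
    have closed_U: "?f u \<in> U" if "u \<in> U" for u
      using that outside closed_D DU by (cases "u \<in> D") auto
    note play_U = play_closed[of U G \<tau> \<sigma>1, OF closed_U v]
    then have play_eq: "play G U \<tau> \<sigma>1 v = (\<lambda>n. Some ((?f ^^ n) v))" by auto
    have "even (play_prio G (play G U \<tau> \<sigma>1 v))"
    proof (cases "\<exists>N. (?f ^^ N) v \<in> D")
      case True
      then obtain N where N: "(?f ^^ N) v \<in> D" ..
      let ?u = "(?f ^^ N) v"
      have play_D: "(step G \<sigma> \<sigma>1 ^^ n) ?u \<in> D \<and> play G D \<sigma> \<sigma>1 ?u n = Some ((step G \<sigma> \<sigma>1 ^^ n) ?u)" for n
        using closed_D N by (intro play_closed) (auto simp: step_D)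
      have "(step G \<sigma> \<sigma>1 ^^ n) ?u = (?f ^^ (n + N)) v" for n
        
      proof (induction n)
        case (Suc n)
        with step_D[OF conjunct1[OF play_D[of n]]] show ?case by simp
      qed simp
      then have "play G D \<sigma> \<sigma>1 ?u = (\<lambda>n. play G U \<tau> \<sigma>1 v (n + N))"
        using play_D play_eq by auto
      then show ?thesis using win[OF \<sigma>1D N] play_prio_shift[of G _ N] by metis
    next
      case False
      have "h ((?f ^^ n) v) \<le> h ((?f ^^ Suc n) v) + delta (prio G ((?f ^^ n) v))" for n
      proof -
        have "(?f ^^ n) v \<in> U - D" "?f ((?f ^^ n) v) \<notin> D"
          using play_U False funpow.simps(2)[of n ?f] by (metis DiffI, metis comp_apply)
        then show ?thesis using outside[of "(?f ^^ n) v"] by simp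
      qed
      moreover have "finite U"
        using G U by (auto simp: parity_game_def positions_def intro: finite_subset)
      ultimately show ?thesis
        unfolding play_eq using play_U by (intro potential_even[of U _ h]) auto
    qed
    with play_U show ?thesis by simp
  qed
  with \<tau> U show ?thesis unfolding dominion0_def by blast
qed

text \<open>Plays in a 0-dominion never stop, so their second position is still in \<open>D\<close>.
  For player 1 this is applied to a strategy redirected at \<open>v\<close> to an arbitrary
  successor. It serves to show that positions of measure \<open>Top\<close> never escape.\<close>

lemma dominion0_succs:
  assumes G: "parity_game G" and D: "dominion0 G D" and v: "v \<in> D"
  shows "v \<in> pos0 G \<Longrightarrow> succs G v \<inter> D \<noteq> {}" and "v \<in> pos1 G \<Longrightarrow> succs G v \<subseteq> D"
proof -
  from D obtain \<sigma> where \<sigma>: "strategy_on G (pos0 G) D \<sigma>"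
    and win: "\<And>\<sigma>1. strategy_on G (pos1 G) D \<sigma>1 \<Longrightarrow> play G D \<sigma> \<sigma>1 v 1 \<noteq> None"
    using v unfolding dominion0_def by blast
  have D_pos: "D \<subseteq> positions G" using D by (simp add: dominion0_def)
  have step: "step G \<sigma> ((\<lambda>u. SOME w. w \<in> succs G u)(v := w)) v \<in> D" if "w \<in> succs G v" for w
  proof -
    have "(SOME w. w \<in> succs G u) \<in> succs G u" if "u \<in> D" for u
      using that D_pos G by (auto simp: parity_game_def some_in_eq)
    then have "strategy_on G (pos1 G) D ((\<lambda>u. SOME w. w \<in> succs G u)(v := w))"
      using that by (auto simp: strategy_on_def succs_def)
    from win[OF this] v show ?thesis by (simp add: step_def Let_def split: if_splits)
  qed
  show "succs G v \<inter> D \<noteq> {}" if "v \<in> pos0 G"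
  proof -
    have "\<sigma> v \<in> succs G v" using \<sigma> v that by (simp add: strategy_on_def succs_def)
    with step that show ?thesis by (auto simp: step_def)
  qed
  show "succs G v \<subseteq> D" if "v \<in> pos1 G"
  proof
    fix w assume "w \<in> succs G v"
    moreover have "v \<notin> pos0 G" using that G by (auto simp: parity_game_def)
    ultimately show "w \<in> D" using step[of w] by (simp add: step_def)
  qed
qed

section \<open>The progress operators\<close>

lemma Max_compr:
  fixes f :: "'a \<Rightarrow> 'b :: linorder"
  assumes "finite A" "A \<noteq> {}"
  shows "\<exists>w \<in> A. Max {f w |w. w \<in> A} = f w \<and> (\<forall>u \<in> A. f u \<le> f w)"
  using Max_in[of "f ` A"] Max_ge[of "f ` A"] assms unfolding Setcompr_eq_image by fastforce

lemma Min_compr: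
  fixes f :: "'a \<Rightarrow> 'b :: linorder"
  assumes "finite A" "A \<noteq> {}"
  shows "\<exists>w \<in> A. Min {f w |w. w \<in> A} = f w \<and> (\<forall>u \<in> A. f w \<le> f u)"
  using Min_in[of "f ` A"] Min_le[of "f ` A"] assms unfolding Setcompr_eq_image by fastforce

lemma SQDMF_iff:
  assumes G: "parity_game G"
  shows "\<mu> \<in> SQDMF G \<longleftrightarrow> \<mu> \<in> SMF G \<and>
    (\<forall>v \<in> positions G. \<mu> v \<noteq> Bot \<longrightarrow> \<mu> v \<noteq> Top \<longrightarrow>
      (v \<in> pos0 G \<longrightarrow> (\<exists>w \<in> succs G v. \<mu> v \<le> stretch G (\<mu> w) v)) \<and>
      (v \<in> pos1 G \<longrightarrow> (\<forall>w \<in> succs G v. \<mu> v \<le> stretch G (\<mu> w) v))) \<and>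
    dominion0 G {v \<in> positions G. \<mu> v = Top}"
proof (cases "\<mu> \<in> SMF G")
  case True
  then have "D_plus G \<mu> - D_zero G \<mu> = {v \<in> positions G. \<mu> v \<noteq> Bot \<and> \<mu> v \<noteq> Top}"
    using SMF_D_plus[OF G] by (auto simp: D_zero_eq)
  then have "(\<forall>v \<in> D_plus G \<mu> - D_zero G \<mu>. R v) \<longleftrightarrow>
      (\<forall>v \<in> positions G. \<mu> v \<noteq> Bot \<longrightarrow> \<mu> v \<noteq> Top \<longrightarrow> R v)" for R
    by auto
  then show ?thesis
    using True unfolding SQDMF_def quasi_dominion_measure_def regress_measure_def
    by (simp add: D_zero_eq)
qed (simp add: SQDMF_def)

locale sqdm =
  fixes G :: "'v game" and \<mu> :: "'v \<Rightarrow> meas"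
  assumes game: "parity_game G" and sqdm: "\<mu> \<in> SQDMF G"
begin

abbreviation P :: "'v set" where
  "P \<equiv> {v \<in> positions G. \<mu> v \<noteq> Bot}"

abbreviation D :: "'v set" where
  "D \<equiv> {v \<in> positions G. \<mu> v = Top}"

lemma smf: "\<mu> \<in> SMF G"
  using sqdm by (simp add: SQDMF_def)

lemma mf: "\<mu> \<in> MF G"
  using smf by (simp add: SMF_def)

lemma simple: "v \<in> positions G \<Longrightarrow> \<mu> v \<in> simple_measures G v P"
  using smf SMF_iff[OF game] by blast

lemma ge_Bot: "v \<in> positions G \<Longrightarrow> Bot \<le> \<mu> v"
  by (rule simple_measures_ge_Bot[OF simple])

lemma regress:
  assumes "v \<in> P" "\<mu> v \<noteq> Top"
  shows "v \<in> pos0 G \<Longrightarrow> \<exists>w \<in> succs G v. \<mu> v \<le> stretch G (\<mu> w) v"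
    and "v \<in> pos1 G \<Longrightarrow> w \<in> succs G v \<Longrightarrow> \<mu> v \<le> stretch G (\<mu> w) v"
  using SQDMF_iff[OF game, THEN iffD1, OF sqdm, THEN conjunct2, THEN conjunct1] assms by simp_all

lemma dominion: "dominion0 G D"
  using SQDMF_iff[OF game, THEN iffD1, OF sqdm] by (elim conjE)

lemma succs_positions: "succs G v \<subseteq> positions G"
  using game by (auto simp: parity_game_def succs_def)

lemma finite_positions: "finite (positions G)"
  using game by (simp add: parity_game_def positions_def)

lemma finite_succs: "finite (succs G v)"
  using succs_positions finite_positions finite_subset by blast

lemma succs_nonempty: "v \<in> positions G \<Longrightarrow> succs G v \<noteq> {}"
  using game by (simp add: parity_game_def)

lemma positions_cases [consumes 1]:
  assumes "v \<in> positions G"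
  obtains "v \<in> pos0 G" "v \<notin> pos1 G" | "v \<in> pos1 G" "v \<notin> pos0 G"
  using assms game by (auto simp: positions_def parity_game_def)

lemma MF_measures: "\<nu> \<in> MF G \<Longrightarrow> v \<in> positions G \<Longrightarrow> \<nu> v \<in> measures G"
  by (auto simp: MF_def)

text \<open>Above \<open>Bot\<close> the regress inequality loses its cut-off; in this additive form
  it can be shifted by a common amount and summed along plays.\<close>

lemma potential_le:
  assumes "v \<in> P" "\<mu> v = Val a" "\<mu> w = Val b" "\<mu> v \<le> stretch G (\<mu> w) v"
  shows "a \<le> b + delta (prio G v)"
  using assms ge_Bot[of v] by (intro le_stretchD) auto

section \<open>The operator raising positions of measure \<open>Bot\<close>\<close>

lemma prg_bot_unchanged: "v \<notin> positions G \<or> \<mu> v \<noteq> Bot \<Longrightarrow> prg_bot G \<mu> v = \<mu> v"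
  by (auto simp: prg_bot_def lift_def SMF_D_bot[OF game smf])

lemma prg_bot_pos0:
  assumes v: "v \<in> pos0 G" "\<mu> v = Bot"
  shows "\<exists>w \<in> succs G v. prg_bot G \<mu> v = stretch G (\<mu> w) v"
proof -
  have pos: "v \<in> positions G" using v by (simp add: positions_def)
  then have "prg_bot G \<mu> v = Max {stretch G (\<mu> w) v |w. w \<in> succs G v \<inter> positions G}"
    using v by (simp add: prg_bot_def lift_def SMF_D_bot[OF game smf])
  then show ?thesis
    using Max_compr[of "succs G v" "\<lambda>w. stretch G (\<mu> w) v"] finite_succs succs_nonempty[OF pos]
      Int_absorb2[OF succs_positions] by auto
qed

lemma prg_bot_pos1:
  assumes v: "v \<in> pos1 G" "\<mu> v = Bot"
  shows "\<exists>w \<in> succs G v. prg_bot G \<mu> v = stretch G (\<mu> w) v \<and>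
    (\<forall>u \<in> succs G v. stretch G (\<mu> w) v \<le> stretch G (\<mu> u) v)"
proof -
  have pos: "v \<in> positions G" using v by (simp add: positions_def)
  then have "v \<notin> pos0 G" using v by (auto elim: positions_cases)
  with pos have "prg_bot G \<mu> v = Min {stretch G (\<mu> w) v |w. w \<in> succs G v \<inter> positions G}"
    using v by (simp add: prg_bot_def lift_def SMF_D_bot[OF game smf])
  then show ?thesis
    using Min_compr[of "succs G v" "\<lambda>w. stretch G (\<mu> w) v"] finite_succs succs_nonempty[OF pos]
      Int_absorb2[OF succs_positions] by auto
qed

lemma prg_bot_cases:
  assumes "v \<in> positions G"
  obtains "prg_bot G \<mu> v = \<mu> v" "\<mu> v \<noteq> Bot"
    | w where "\<mu> v = Bot" "w \<in> succs G v" "prg_bot G \<mu> v = stretch G (\<mu> w) v"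
  using assms that prg_bot_unchanged prg_bot_pos0 prg_bot_pos1 by (metis positions_cases)

lemma prg_bot_le: "v \<in> positions G \<Longrightarrow> \<mu> v \<le> prg_bot G \<mu> v"
  by (cases rule: prg_bot_cases[of v]) auto

lemma prg_bot_SMF: "prg_bot G \<mu> \<in> SMF G"
  unfolding SMF_iff[OF game]
proof (intro conjI ballI)
  show "prg_bot G \<mu> \<in> MF G"
    unfolding MF_def
  proof (rule PiE_I)
    fix v assume v: "v \<in> positions G"
    from v show "prg_bot G \<mu> v \<in> measures G"
    proof (cases rule: prg_bot_cases)
      case (2 w)
      then show ?thesis
        using stretch_measures[OF game v] MF_measures[OF mf] succs_positions by auto
    qed (use MF_measures[OF mf v] in simp)
  next
    fix v assume "v \<notin> positions G"
    then show "prg_bot G \<mu> v = undefined"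
      using prg_bot_unchanged mf by (auto simp: MF_def)
  qed
next
  let ?Y = "{v \<in> positions G. prg_bot G \<mu> v \<noteq> Bot}"
  have sub: "P \<subseteq> ?Y" by (auto simp: prg_bot_unchanged)
  fix v assume v: "v \<in> positions G"
  then show "prg_bot G \<mu> v \<in> simple_measures G v ?Y"
  proof (cases rule: prg_bot_cases)
    case 1
    then show ?thesis using simple[OF v] simple_measures_mono[OF sub] by auto
  next
    case (2 w)
    \<comment> \<open>If the new value is \<open>Bot\<close>, then \<open>v\<close> is not in
      \<open>?Y\<close> and cannot head a path, but the empty path serves. Otherwise the path of
      \<open>w\<close> stays in \<open>P\<close>, to which \<open>v\<close> did not belong.\<close>
    show ?thesis
    proof (cases "prg_bot G \<mu> v = Bot")
      case False
      have "\<mu> w \<in> simple_measures G w P" using simple succs_positions 2 by blast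
      then have "stretch G (\<mu> w) v \<in> simple_measures G v ?Y"
        using 2 False v sub by (intro stretch_simple_measures) auto
      then show ?thesis using 2 by simp
    qed simp
  qed
qed

text \<open>A changed position reads the old measures, and these only grow, so monotonicity of
  \<open>stretch\<close> turns its defining equation into the new regress inequality; an unchanged
  one keeps its old inequality.\<close>

lemma prg_bot_SQDMF: "prg_bot G \<mu> \<in> SQDMF G"
  unfolding SQDMF_iff[OF game]
proof (intro conjI ballI impI prg_bot_SMF)
  have mono: "stretch G (\<mu> w) v \<le> stretch G (prg_bot G \<mu> w) v" if "w \<in> succs G v" for v w
    using that succs_positions by (intro stretch_mono prg_bot_le) auto
  fix v assume v: "v \<in> positions G" "prg_bot G \<mu> v \<noteq> Bot" "prg_bot G \<mu> v \<noteq> Top"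
  show "\<exists>w \<in> succs G v. prg_bot G \<mu> v \<le> stretch G (prg_bot G \<mu> w) v" if "v \<in> pos0 G"
  proof (cases "\<mu> v = Bot")
    case True
    then show ?thesis using prg_bot_pos0 that mono by (metis)
  next
    case False
    with v that obtain w where "w \<in> succs G v" "\<mu> v \<le> stretch G (\<mu> w) v"
      using regress(1)[of v] by (auto simp: prg_bot_unchanged)
    with False show ?thesis using mono prg_bot_unchanged by (metis order_trans)
  qed
  show "prg_bot G \<mu> v \<le> stretch G (prg_bot G \<mu> w) v" if "v \<in> pos1 G" "w \<in> succs G v" for w
  proof (cases "\<mu> v = Bot")
    case True
    then show ?thesis using prg_bot_pos1 that mono by (metis order_trans)
  next
    case False
    with v that have "\<mu> v \<le> stretch G (\<mu> w) v"
      using regress(2)[of v] by (auto simp: prg_bot_unchanged)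
    with False show ?thesis using mono that prg_bot_unchanged by (metis order_trans)
  qed
next
  let ?U = "{v \<in> positions G. prg_bot G \<mu> v = Top}"
  have DU: "D \<subseteq> ?U" by (auto simp: prg_bot_unchanged)
  show "dominion0 G ?U"
  \<comment> \<open>A position whose measure becomes \<open>Top\<close> moves directly into
    \<open>D\<close>, by a maximizing move of player 0 or by every move of player 1; hence any
    constant serves as potential.\<close>
  proof (rule dominion_extend[OF game dominion DU, where h = "\<lambda>_. 0"])
    fix v assume v: "v \<in> ?U - D"
    then have Bot: "\<mu> v = Bot" using prg_bot_unchanged by force
    show "\<exists>w \<in> succs G v \<inter> ?U. w \<in> D \<or> 0 \<le> 0 + delta (prio G v)" if pos0: "v \<in> pos0 G"
    proof -
      from prg_bot_pos0[OF pos0 Bot] obtain w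
        where w: "w \<in> succs G v" "prg_bot G \<mu> v = stretch G (\<mu> w) v" by blast
      then have "stretch G (\<mu> w) v = Top" using v by simp
      with w have "w \<in> D" using succs_positions by auto
      with w DU show ?thesis by blast
    qed
    show "w \<in> ?U \<and> (w \<in> D \<or> 0 \<le> 0 + delta (prio G v))" if "v \<in> pos1 G" "w \<in> succs G v" for w
    proof -
      from prg_bot_pos1[OF that(1) Bot] have "\<mu> w = Top" using v that by auto
      then have "w \<in> D" using succs_positions that by blast
      with DU show ?thesis by blast
    qed
  qed auto
qed

section \<open>The escape iteration of \<open>prg_plus\<close>\<close>

text \<open>
  The invariant of the iteration in \<open>prg_plus\<close>: \<open>f\<close> is the largest forfeit used so far, so no
  position that has already left \<open>Q\<close> was raised by more than \<open>f\<close>. Since all further forfeits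
  are at least \<open>f\<close>, see \<open>bounded\<close>, the regress inequality at a position of player 1 that has
  left \<open>Q\<close> survives when one of its successors leaves \<open>Q\<close> later.
\<close>

definition inv :: "('v \<Rightarrow> meas) \<Rightarrow> 'v set \<Rightarrow> evaluation \<Rightarrow> bool" where
  "inv \<nu> Q f \<longleftrightarrow> 0 \<le> f \<and> \<nu> \<in> MF G \<and> D \<subseteq> Q \<and> Q \<subseteq> P \<and>
     (\<forall>v \<in> Q. \<nu> v = \<mu> v) \<and> (\<forall>v \<in> positions G - P. \<nu> v = Bot) \<and>
     (\<forall>v \<in> P - Q.
        (\<exists>a b. \<mu> v = Val a \<and> \<nu> v = Val b \<and> a \<le> b \<and> b \<le> a + f) \<and>
        \<nu> v \<in> simple_measures G v (P - Q) \<and>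
        (v \<in> pos0 G \<longrightarrow> (\<exists>w \<in> succs G v - Q. \<nu> v \<le> stretch G (\<nu> w) v)) \<and>
        (v \<in> pos1 G \<longrightarrow> (\<forall>w \<in> succs G v - Q. \<nu> v \<le> stretch G (\<nu> w) v)))"

definition bounded :: "('v \<Rightarrow> meas) \<Rightarrow> 'v set \<Rightarrow> evaluation \<Rightarrow> bool" where
  "bounded \<nu> Q f \<longleftrightarrow> (\<forall>v \<in> Q. Val f \<le> bef G \<nu> Q v)"

lemma invD:
  assumes "inv \<nu> Q f"
  shows "0 \<le> f" "\<nu> \<in> MF G" "D \<subseteq> Q" "Q \<subseteq> P"
    "v \<in> Q \<Longrightarrow> \<nu> v = \<mu> v" "v \<in> positions G - P \<Longrightarrow> \<nu> v = Bot"
    "v \<in> P - Q \<Longrightarrow> \<exists>a b. \<mu> v = Val a \<and> \<nu> v = Val b \<and> a \<le> b \<and> b \<le> a + f"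
    "v \<in> positions G - Q \<Longrightarrow> \<nu> v \<in> simple_measures G v (P - Q)"
    "v \<in> P - Q \<Longrightarrow> v \<in> pos0 G \<Longrightarrow> \<exists>w \<in> succs G v - Q. \<nu> v \<le> stretch G (\<nu> w) v"
    "v \<in> P - Q \<Longrightarrow> v \<in> pos1 G \<Longrightarrow> w \<in> succs G v - Q \<Longrightarrow> \<nu> v \<le> stretch G (\<nu> w) v"
proof -
  note inv = assms[unfolded inv_def]
  show "0 \<le> f" "\<nu> \<in> MF G" "D \<subseteq> Q" "Q \<subseteq> P" "v \<in> Q \<Longrightarrow> \<nu> v = \<mu> v"
    "v \<in> positions G - P \<Longrightarrow> \<nu> v = Bot"
    "v \<in> P - Q \<Longrightarrow> \<exists>a b. \<mu> v = Val a \<and> \<nu> v = Val b \<and> a \<le> b \<and> b \<le> a + f"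
    "v \<in> P - Q \<Longrightarrow> v \<in> pos0 G \<Longrightarrow> \<exists>w \<in> succs G v - Q. \<nu> v \<le> stretch G (\<nu> w) v"
    "v \<in> P - Q \<Longrightarrow> v \<in> pos1 G \<Longrightarrow> w \<in> succs G v - Q \<Longrightarrow> \<nu> v \<le> stretch G (\<nu> w) v"
    using inv by blast+
  show "\<nu> v \<in> simple_measures G v (P - Q)" if v: "v \<in> positions G - Q"
  proof (cases "v \<in> P")
    case True
    then show ?thesis using inv v by blast
  next
    case False
    then have "\<nu> v = Bot" using inv v by blast
    then show ?thesis by simp
  qed
qed

text \<open>Positions that left \<open>Q\<close> had an evaluation as measure, because
  \<open>D\<close> stays inside \<open>Q\<close>. So the first argument of \<open>mdiff\<close> in a
  forfeit is never \<open>Top\<close>.\<close>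

lemma inv_Val:
  assumes "inv \<nu> Q f" "v \<in> positions G - Q"
  shows "\<nu> v \<noteq> Top"
proof (cases "v \<in> P")
  case True
  with assms invD(7)[OF assms(1), of v] show ?thesis by auto
next
  case False
  with assms invD(6)[OF assms(1), of v] show ?thesis by auto
qed

text \<open>Makes the extrema in \<open>bef\<close> and \<open>lift\<close> usable. An escaping
  position is not in \<open>D\<close>, since a 0-dominion offers player 0 a move within it and
  confines player 1; it has a successor outside \<open>Q\<close>, since for player 0 the regress
  move cannot lie in \<open>Q\<close>. The value \<open>c\<close> is the stretched measure of the
  outside successor that is best for the owner.\<close>

lemma escE:
  assumes inv: "inv \<nu> Q f" and esc: "v \<in> esc G \<nu> Q"
  obtains w a c where "w \<in> succs G v - Q" "\<mu> v = Val a" "stretch G (\<nu> w) v = Val c"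
    "bef G \<nu> Q v = Val (c - a)" "\<And>S. v \<in> S \<Longrightarrow> lift G \<nu> S (positions G - Q) v = Val c"
    "\<And>u. v \<in> pos0 G \<Longrightarrow> u \<in> succs G v - Q \<Longrightarrow> stretch G (\<nu> u) v \<le> Val c"
    "\<And>u. v \<in> pos1 G \<Longrightarrow> u \<in> succs G v - Q \<Longrightarrow> Val c \<le> stretch G (\<nu> u) v"
    "v \<in> pos0 G \<Longrightarrow> \<exists>u \<in> succs G v - Q. \<mu> v \<le> stretch G (\<mu> u) v"
proof -
  let ?A = "succs G v - Q"
  let ?f = "\<lambda>w. stretch G (\<nu> w) v"
  note I = invD[OF inv]
  have v: "v \<in> Q" "v \<in> P" using esc I(4) by (auto simp: esc_def)
  have esc0: "stretch G (\<mu> w) v < \<mu> v" if "v \<in> pos0 G" "w \<in> succs G v \<inter> Q" for w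
    using esc that I(5) v by (auto simp: esc_def elim: positions_cases)
  have esc1: "?A \<noteq> {}" if "v \<in> pos1 G"
    using esc that game by (auto simp: esc_def parity_game_def)
  have "\<mu> v \<noteq> Top"
  proof
    assume top: "\<mu> v = Top"
    then have D: "v \<in> D" using v by blast
    from v(2) have "v \<in> positions G" by blast
    then show False
    proof (cases rule: positions_cases)
      case 1
      then obtain w where w: "w \<in> succs G v" "w \<in> D"
        using dominion0_succs(1)[OF game dominion D] by blast
      then show False using esc0[of w] 1 I(3) top by (auto simp: less_meas_def)
    next
      case 2
      then show False using dominion0_succs(2)[OF game dominion D] esc1 I(3) by blast
    qed
  qed
  then obtain a where a: "\<mu> v = Val a" by (cases "\<mu> v") auto
  have reg0: "\<exists>u \<in> ?A. \<mu> v \<le> stretch G (\<mu> u) v" if pos0: "v \<in> pos0 G"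
  proof -
    from regress(1)[OF v(2) \<open>\<mu> v \<noteq> Top\<close> pos0] obtain u
      where u: "u \<in> succs G v" "\<mu> v \<le> stretch G (\<mu> u) v" by blast
    then have "u \<notin> Q" using esc0[OF pos0, of u] by auto
    with u show ?thesis by blast
  qed
  have finA: "finite ?A" using finite_succs by simp
  have neA: "?A \<noteq> {}"
    using reg0 esc1 v by (auto simp: positions_def)
  have T: "succs G v \<inter> (positions G - Q) = ?A"
    using succs_positions by blast
  have not_Top: "?f w \<noteq> Top" if "w \<in> ?A" for w
    using inv_Val[OF inv, of w] that succs_positions by auto
  note nu_v = I(5)[OF v(1)]
  from v(2) have "v \<in> positions G" by blast
  then show thesis
  proof (cases rule: positions_cases)
    case 1
    obtain w where w: "w \<in> ?A" "Max {?f w |w. w \<in> ?A} = ?f w" "\<And>u. u \<in> ?A \<Longrightarrow> ?f u \<le> ?f w"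
      using Max_compr[OF finA neA, of ?f] by blast
    obtain c where c: "?f w = Val c" using not_Top[OF w(1)] by (cases "?f w") auto
    \<comment> \<open>Subtracting the fixed evaluation \<open>a\<close> is monotone below
      \<open>Top\<close>, so the same \<open>w\<close> is optimal for the measure and for the
      forfeit.\<close>
    have "Max {mdiff (?f w) (\<nu> v) |w. w \<in> ?A} = mdiff (?f w) (\<nu> v)"
      unfolding Setcompr_eq_image using w not_Top finA nu_v a
      by (intro Max_eqI) (auto intro!: mdiff_mono)
    then have "bef G \<nu> Q v = Val (c - a)"
      using 1 esc nu_v a c by (simp add: bef_def)
    with w c a 1 T reg0 show thesis by (intro that[of w a c]) (auto simp: lift_def)
  next
    case 2
    obtain w where w: "w \<in> ?A" "Min {?f w |w. w \<in> ?A} = ?f w" "\<And>u. u \<in> ?A \<Longrightarrow> ?f w \<le> ?f u"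
      using Min_compr[OF finA neA, of ?f] by blast
    obtain c where c: "?f w = Val c" using not_Top[OF w(1)] by (cases "?f w") auto
    have "Min {mdiff (?f w) (\<nu> v) |w. w \<in> ?A} = mdiff (?f w) (\<nu> v)"
      unfolding Setcompr_eq_image using w not_Top finA nu_v a
      by (intro Min_eqI) (auto intro!: mdiff_mono)
    then have "bef G \<nu> Q v = Val (c - a)"
      using 2 esc nu_v a c by (simp add: bef_def)
    with w c a 2 T show thesis by (intro that[of w a c]) (auto simp: lift_def)
  qed
qed

lemma bef_not_esc: "v \<notin> esc G \<nu> Q \<Longrightarrow> bef G \<nu> Q v = Top"
  by (simp add: bef_def)

text \<open>Initial forfeits are nonnegative by regress: player 1 has the inequality for every
  successor, and for player 0 the regress move leaves \<open>P\<close> and is dominated by the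
  maximum.\<close>

lemma inv_init: "inv \<mu> P 0" and bounded_init: "bounded \<mu> P 0"
proof -
  show inv: "inv \<mu> P 0"
    unfolding inv_def using mf by auto
  show "bounded \<mu> P 0"
    unfolding bounded_def
  proof
    fix v assume v: "v \<in> P"
    show "Val 0 \<le> bef G \<mu> P v"
    proof (cases "v \<in> esc G \<mu> P")
      case True
      obtain w a c where w: "w \<in> succs G v - P" "\<mu> v = Val a" "stretch G (\<mu> w) v = Val c"
        "bef G \<mu> P v = Val (c - a)"
        "\<And>u. v \<in> pos0 G \<Longrightarrow> u \<in> succs G v - P \<Longrightarrow> stretch G (\<mu> u) v \<le> Val c"
        "v \<in> pos0 G \<Longrightarrow> \<exists>u \<in> succs G v - P. \<mu> v \<le> stretch G (\<mu> u) v"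
        by (rule escE[OF inv True]) blast
      have "\<mu> v \<le> Val c"
      proof (cases "v \<in> pos0 G")
        case True
        then show ?thesis using w(5,6) order_trans by blast
      next
        case False
        then have "v \<in> pos1 G" using v by (auto simp: positions_def)
        with regress(2)[OF v, of w] w show ?thesis by auto
      qed
      then show ?thesis using w by simp
    qed (simp add: bef_not_esc)
  qed
qed

text \<open>The witness is the forfeit \<open>g\<close> common to all of \<open>E\<close>;
  \<open>bounded\<close> for the old \<open>f\<close> gives \<open>f \<le> g\<close>, so the
  tolerance allowed to positions that left earlier only widens.\<close>

lemma prg_plus_step:
  assumes inv: "inv \<nu> Q f" and bd: "bounded \<nu> Q f"
  defines "E \<equiv> bep G \<nu> Q"
  defines "\<nu>' \<equiv> lift G \<nu> E (positions G - Q)"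
  assumes ne: "E \<noteq> {}"
  shows "\<exists>g. inv \<nu>' (Q - E) g \<and> bounded \<nu>' (Q - E) g"
proof -
  note I = invD[OF inv]
  have E_esc: "E \<subseteq> esc G \<nu> Q" by (auto simp: E_def bep_def)
  moreover have "esc G \<nu> Q \<subseteq> Q" by (auto simp: esc_def)
  ultimately have EQ: "E \<subseteq> Q" by blast
  from ne obtain e where e: "e \<in> E" by blast
  obtain g where g: "bef G \<nu> Q e = Val g"
    using escE[OF inv, of e] e E_esc by (metis subsetD)
  have g_min: "Val g \<le> bef G \<nu> Q v" if "v \<in> Q" for v
    using e g that by (auto simp: E_def bep_def)
  have g_E: "bef G \<nu> Q v = Val g" if "v \<in> E" for v
  proof (rule antisym)
    show "bef G \<nu> Q v \<le> Val g"
      using that e EQ unfolding g[symmetric] by (auto simp: E_def bep_def)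
    show "Val g \<le> bef G \<nu> Q v" using that EQ g_min by blast
  qed
  have fg: "f \<le> g" using bd e EQ g unfolding bounded_def by fastforce
  have unchanged: "\<nu>' v = \<nu> v" if "v \<notin> E" for v
    using that by (simp add: \<nu>'_def lift_def)
  have raised: "\<exists>a. \<mu> v = Val a \<and> \<nu>' v = Val (a + g) \<and>
      (\<exists>w \<in> succs G v - Q. \<nu>' v = stretch G (\<nu> w) v) \<and>
      (v \<in> pos1 G \<longrightarrow> (\<forall>u \<in> succs G v - Q. \<nu>' v \<le> stretch G (\<nu> u) v))" if v: "v \<in> E" for v
  proof -
    obtain w a c where w: "w \<in> succs G v - Q" "\<mu> v = Val a" "stretch G (\<nu> w) v = Val c"
      "bef G \<nu> Q v = Val (c - a)" "\<And>S. v \<in> S \<Longrightarrow> lift G \<nu> S (positions G - Q) v = Val c"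
      "\<And>u. v \<in> pos1 G \<Longrightarrow> u \<in> succs G v - Q \<Longrightarrow> Val c \<le> stretch G (\<nu> u) v"
      by (rule escE[OF inv, of v]) (use v E_esc in blast)+
    have \<nu>': "\<nu>' v = Val c" unfolding \<nu>'_def by (rule w(5)[OF v])
    have "c - a = g" using w(4) g_E[OF v] by simp
    then have "c = a + g" by (simp add: algebra_simps)
    with \<nu>' w show ?thesis by metis
  qed
  \<comment> \<open>The regress inequality translated by \<open>g\<close>. The bound
    \<open>x \<le> a + g\<close> in place of an equality also covers positions \<open>v\<close> that
    left earlier and rose by less.\<close>
  have E_stretch: "Val x \<le> stretch G (\<nu>' u) v"
    if v: "v \<in> P" "\<mu> v = Val a" and x: "x \<le> a + g" and u: "u \<in> E"
      and le: "\<mu> v \<le> stretch G (\<mu> u) v" for v a x u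
  proof -
    obtain b where b: "\<mu> u = Val b" "\<nu>' u = Val (b + g)" using raised[OF u] by blast
    have "a \<le> b + delta (prio G v)" using potential_le[OF v b(1) le] .
    then have "a + g \<le> b + g + delta (prio G v)" by (simp add: algebra_simps)
    with x have "x \<le> b + g + delta (prio G v)" by (rule order_trans)
    with b show ?thesis by (simp add: le_max_iff_disj)
  qed
  have P_Q': "v \<in> P - Q \<or> v \<in> E" if "v \<in> P - (Q - E)" for v
    using that by blast
  have regress1: "\<nu>' v \<le> stretch G (\<nu>' u) v"
    if v: "v \<in> P - (Q - E)" "v \<in> pos1 G" and u: "u \<in> succs G v - (Q - E)" for v u
  proof -
    \<comment> \<open>Both kinds of departed positions lie at most \<open>g\<close> above their old
      measure: those in \<open>E\<close> by equality, the earlier ones through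
      \<open>f \<le> g\<close>.\<close>
    obtain a x where a: "\<mu> v = Val a" "\<nu>' v = Val x" "x \<le> a + g"
    proof (cases "v \<in> E")
      case True
      then show ?thesis using raised that by blast
    next
      case False
      with v have "v \<in> P - Q" by blast
      from I(7)[OF this] obtain a b where "\<mu> v = Val a" "\<nu> v = Val b" "b \<le> a + f" by blast
      moreover from this fg have "b \<le> a + g" by (meson add_left_mono order_trans)
      ultimately show ?thesis using that unchanged[OF False] by simp
    qed
    show ?thesis
    proof (cases "u \<in> E")
      case True
      have "\<mu> v \<le> stretch G (\<mu> u) v" using v u a by (intro regress(2)) auto
      with E_stretch[OF _ a(1,3) True] v a show ?thesis by auto
    next
      case False
      with u have u: "u \<in> succs G v - Q" by blast
      show ?thesis
      proof (cases "v \<in> E")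
        case True
        then show ?thesis using raised[OF True] u v unchanged[OF False] by auto
      next
        case False
        with v have "v \<in> P - Q" by blast
        with I(10)[OF this v(2) u] show ?thesis using unchanged \<open>u \<notin> E\<close> False by simp
      qed
    qed
  qed
  have inv': "inv \<nu>' (Q - E) g"
    unfolding inv_def
  proof (intro conjI ballI impI)
    show "0 \<le> g" using I(1) fg by simp
    show "\<nu>' \<in> MF G"
      unfolding MF_def
    proof (rule PiE_I)
      fix v assume v: "v \<in> positions G"
      show "\<nu>' v \<in> measures G"
      proof (cases "v \<in> E")
        case True
        from raised[OF this] obtain w where "w \<in> succs G v" "\<nu>' v = stretch G (\<nu> w) v" by blast
        then show ?thesis
          using stretch_measures[OF game v] MF_measures[OF I(2)] succs_positions by auto
      qed (use v unchanged MF_measures[OF I(2)] in simp)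
    next
      fix v assume "v \<notin> positions G"
      moreover from this have "v \<notin> E" using EQ I(4) by blast
      ultimately show "\<nu>' v = undefined" using unchanged I(2) by (auto simp: MF_def)
    qed
    \<comment> \<open>Positions in \<open>E\<close> carry an evaluation, so none of them is in
      \<open>D\<close>.\<close>
    show "D \<subseteq> Q - E" using I(3) raised by force
    show "Q - E \<subseteq> P" using I(4) by blast
    show "\<nu>' v = \<mu> v" if "v \<in> Q - E" for v using that unchanged I(5) by simp
    show "\<nu>' v = Bot" if "v \<in> positions G - P" for v
    proof -
      have "v \<notin> E" using that EQ I(4) by blast
      then show ?thesis using that unchanged I(6) by simp
    qed
    show "\<exists>a b. \<mu> v = Val a \<and> \<nu>' v = Val b \<and> a \<le> b \<and> b \<le> a + g" if v: "v \<in> P - (Q - E)" for v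
    proof (cases "v \<in> E")
      case True
      have "0 \<le> g" using I(1) fg by simp
      with raised[OF True] show ?thesis by auto
    next
      case False
      with v have "v \<in> P - Q" by blast
      from I(7)[OF this] obtain a b where "\<mu> v = Val a" "\<nu> v = Val b" "a \<le> b" "b \<le> a + f" by blast
      moreover from this fg have "b \<le> a + g" by (meson add_left_mono order_trans)
      ultimately show ?thesis using unchanged[OF False] by simp
    qed
    show "\<nu>' v \<in> simple_measures G v (P - (Q - E))" if v: "v \<in> P - (Q - E)" for v
    proof (cases "v \<in> E")
      case True
      from raised[OF this] obtain w where w: "w \<in> succs G v - Q" "\<nu>' v = stretch G (\<nu> w) v" by blast
      then have "\<nu> w \<in> simple_measures G w (P - Q)" using I(8) succs_positions by blast
      then have "stretch G (\<nu> w) v \<in> simple_measures G v (P - (Q - E))"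
        using w True EQ v by (intro stretch_simple_measures[of _ _ w "P - Q"]) auto
      then show ?thesis using w by simp
    next
      case False
      with v have "v \<in> positions G - Q" by blast
      from I(8)[OF this] show ?thesis
        using unchanged[OF False] simple_measures_mono[of "P - Q" "P - (Q - E)" G v] by auto
    qed
    show "\<exists>w \<in> succs G v - (Q - E). \<nu>' v \<le> stretch G (\<nu>' w) v"
      if v: "v \<in> P - (Q - E)" "v \<in> pos0 G" for v
    proof -
      have "\<exists>w \<in> succs G v - Q. \<nu>' v \<le> stretch G (\<nu> w) v"
      proof (cases "v \<in> E")
        case True
        from raised[OF this] obtain w where "w \<in> succs G v - Q" "\<nu>' v = stretch G (\<nu> w) v" by blast
        then show ?thesis by (metis order_refl)
      next
        case False
        then show ?thesis using I(9) v unchanged by auto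
      qed
      then obtain w where w: "w \<in> succs G v - Q" "\<nu>' v \<le> stretch G (\<nu> w) v" by blast
      then have "\<nu>' w = \<nu> w" using EQ by (intro unchanged) blast
      with w have "w \<in> succs G v - (Q - E)" "\<nu>' v \<le> stretch G (\<nu>' w) v" by simp_all
      then show ?thesis ..
    qed
    show "\<nu>' v \<le> stretch G (\<nu>' w) v"
      if "v \<in> P - (Q - E)" "v \<in> pos1 G" "w \<in> succs G v - (Q - E)" for v w
      using that by (rule regress1)
  qed
  have "bounded \<nu>' (Q - E) g"
    unfolding bounded_def
  proof
    fix v assume v: "v \<in> Q - E"
    then have vP: "v \<in> P" using I(4) by blast
    show "Val g \<le> bef G \<nu>' (Q - E) v"
    proof (cases "v \<in> esc G \<nu>' (Q - E)")
      case True
      obtain w a c where w: "w \<in> succs G v - (Q - E)" "\<mu> v = Val a" "stretch G (\<nu>' w) v = Val c"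
        "bef G \<nu>' (Q - E) v = Val (c - a)"
        "\<And>u. v \<in> pos0 G \<Longrightarrow> u \<in> succs G v - (Q - E) \<Longrightarrow> stretch G (\<nu>' u) v \<le> Val c"
        by (rule escE[OF inv' True]) blast
      \<comment> \<open>If \<open>v\<close> could escape in the previous round, its forfeit was at
        least \<open>g\<close> then; this bounds one value read outside \<open>Q\<close> for player
        0 and all of them for player 1.\<close>
      have old: "\<exists>w0 \<in> succs G v - Q. Val (a + g) \<le> stretch G (\<nu> w0) v \<and>
          (v \<in> pos1 G \<longrightarrow> (\<forall>u \<in> succs G v - Q. Val (a + g) \<le> stretch G (\<nu> u) v))"
        if esc: "v \<in> esc G \<nu> Q"
      proof -
        obtain w0 a0 c0 where w0: "w0 \<in> succs G v - Q" "\<mu> v = Val a0" "stretch G (\<nu> w0) v = Val c0"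
          "bef G \<nu> Q v = Val (c0 - a0)"
          "\<And>u. v \<in> pos1 G \<Longrightarrow> u \<in> succs G v - Q \<Longrightarrow> Val c0 \<le> stretch G (\<nu> u) v"
          by (rule escE[OF inv esc]) blast
        have "g \<le> c0 - a" using g_min[of v] v w0 w(2) by simp
        then have "Val (a + g) \<le> Val c0" by (simp add: algebra_simps)
        with w0 show ?thesis by (metis order_trans)
      qed
      have "Val (a + g) \<le> Val c"
      proof (cases "v \<in> pos0 G")
        case pos0: True
        have "\<exists>u \<in> succs G v - (Q - E). Val (a + g) \<le> stretch G (\<nu>' u) v"
        proof (cases "v \<in> esc G \<nu> Q")
          case True
          from old[OF this] obtain u where "u \<in> succs G v - Q" "Val (a + g) \<le> stretch G (\<nu> u) v" by blast
          moreover from this have "\<nu>' u = \<nu> u" using EQ by (intro unchanged) blast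
          ultimately have "u \<in> succs G v - (Q - E)" "Val (a + g) \<le> stretch G (\<nu>' u) v" by simp_all
          then show ?thesis ..
        next
          case False
          \<comment> \<open>The successor \<open>u\<close> that held \<open>v\<close> back in the
            previous round no longer does, so it has just left.\<close>
          with v pos0 obtain u where u: "u \<in> succs G v \<inter> Q" "\<not> stretch G (\<nu> u) v < \<nu> v"
            by (auto simp: esc_def)
          have "u \<in> E"
          proof (rule ccontr)
            assume uE: "u \<notin> E"
            have "stretch G (\<nu>' u) v < \<nu>' v"
              using True pos0 u uE game by (auto simp: esc_def parity_game_def)
            with u uE v show False by (simp add: unchanged)
          qed
          moreover have "\<mu> v \<le> stretch G (\<mu> u) v" using u v I(5) by auto
          ultimately have "Val (a + g) \<le> stretch G (\<nu>' u) v"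
            using E_stretch[OF vP w(2)] by blast
          with u \<open>u \<in> E\<close> show ?thesis by blast
        qed
        then show ?thesis using w(5)[OF pos0] order_trans by blast
      next
        case False
        then have pos1: "v \<in> pos1 G" using vP by (auto simp: positions_def)
        show ?thesis
        proof (cases "w \<in> E")
          case True
          have "\<mu> v \<le> stretch G (\<mu> w) v" using w pos1 vP by (intro regress(2)) auto
          with E_stretch[OF vP w(2) order_refl True] w(3) show ?thesis by simp
        next
          case False
          with w(1) have w': "w \<in> succs G v - Q" by blast
          \<comment> \<open>Player 1 could already move from \<open>v\<close> to \<open>w\<close>
            outside the old \<open>Q\<close>, so \<open>v\<close> was escaping in the previous
            round.\<close>
          with v pos1 have "v \<in> esc G \<nu> Q" by (auto simp: esc_def)
          with old pos1 w' have "Val (a + g) \<le> stretch G (\<nu> w) v" by blast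
          then show ?thesis using w(3) unchanged[OF False] by simp
        qed
      qed
      then have "g \<le> c - a" by (simp add: algebra_simps)
      then show ?thesis using w(4) by simp
    qed (simp add: bef_not_esc)
  qed
  with inv' show ?thesis by blast
qed

text \<open>Positions that cannot escape have forfeit \<open>Top\<close>, so a minimum over the
  finite escape set is a minimum over all of \<open>Q\<close>.\<close>

lemma bep_empty_imp_esc_empty:
  assumes inv: "inv \<nu> Q f" and empty: "bep G \<nu> Q = {}"
  shows "esc G \<nu> Q = {}"
proof (rule ccontr)
  let ?A = "esc G \<nu> Q"
  assume ne: "?A \<noteq> {}"
  have "?A \<subseteq> positions G" using invD(4)[OF inv] by (auto simp: esc_def)
  then have "finite ?A" using finite_positions finite_subset by blast
  with ne obtain v where v: "v \<in> ?A" "\<And>u. u \<in> ?A \<Longrightarrow> bef G \<nu> Q v \<le> bef G \<nu> Q u"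
    using Min_compr[of ?A "bef G \<nu> Q"] by blast
  have "bef G \<nu> Q v \<le> bef G \<nu> Q u" for u
    using v(2) by (cases "u \<in> ?A") (auto simp: bef_not_esc)
  with v(1) have "v \<in> bep G \<nu> Q" by (simp add: bep_def)
  with empty show False by blast
qed

text \<open>With no escape left, player 0 has a move inside \<open>Q\<close> that satisfies the
  regress inequality and player 1 cannot leave \<open>Q\<close>; the original \<open>\<mu>\<close>,
  unchanged on \<open>Q\<close>, is then a potential there.\<close>

lemma prg_plus_final:
  assumes inv: "inv \<nu> Q f" and empty: "bep G \<nu> Q = {}"
  defines "\<rho> \<equiv> \<lambda>v. if v \<in> Q then Top else \<nu> v"
  shows "\<rho> \<in> SQDMF G" and "MF_le G \<mu> \<rho>"
proof -
  note I = invD[OF inv]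
  note esc = bep_empty_imp_esc_empty[OF inv empty]
  have le: "\<mu> v \<le> \<rho> v" if v: "v \<in> positions G" for v
  proof -
    consider "v \<in> Q" | "v \<in> P - Q" | "v \<notin> P" "v \<notin> Q" by blast
    then show ?thesis
    proof cases
      case 2
      with I(7)[OF 2] show ?thesis by (auto simp: \<rho>_def)
    next
      case 3
      with I(6)[of v] v show ?thesis by (auto simp: \<rho>_def)
    qed (simp add: \<rho>_def)
  qed
  then show "MF_le G \<mu> \<rho>" by (simp add: MF_le_def)
  \<comment> \<open>The iteration moves no position to or from \<open>Bot\<close>, so simple paths
    are again judged in \<open>P\<close>.\<close>
  have nonBot: "{v \<in> positions G. \<rho> v \<noteq> Bot} = P"
  proof (intro equalityI subsetI)
    fix v assume v: "v \<in> {v \<in> positions G. \<rho> v \<noteq> Bot}"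
    show "v \<in> P"
    proof (rule ccontr)
      assume "v \<notin> P"
      then show False using v I(4) I(6)[of v] by (auto simp: \<rho>_def split: if_splits)
    qed
  next
    fix v assume v: "v \<in> P"
    then have "\<mu> v \<le> \<rho> v" "Bot \<le> \<mu> v" using le ge_Bot by auto
    then have "\<rho> v \<noteq> Bot" using v by (metis (mono_tags, lifting) antisym mem_Collect_eq)
    with v show "v \<in> {v \<in> positions G. \<rho> v \<noteq> Bot}" by blast
  qed
  have top: "{v \<in> positions G. \<rho> v = Top} = Q"
    using I(4) inv_Val[OF inv] by (auto simp: \<rho>_def)
  have "\<rho> \<in> SMF G"
    unfolding SMF_iff[OF game] nonBot
  proof (intro conjI ballI)
    show "\<rho> \<in> MF G"
      using I(2,4) by (auto simp: MF_def \<rho>_def PiE_iff extensional_def)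
    show "\<rho> v \<in> simple_measures G v P" if "v \<in> positions G" for v
      using that I(8)[of v] simple_measures_mono[of "P - Q" P G v] by (auto simp: \<rho>_def)
  qed
  moreover have "dominion0 G Q"
  \<comment> \<open>The value 0 at \<open>Top\<close> is a filler: within \<open>Q\<close> such
    positions form \<open>D\<close>, where the given strategy takes over.\<close>
  proof (rule dominion_extend[OF game dominion I(3), where h = "\<lambda>v. case \<mu> v of Val a \<Rightarrow> a | Top \<Rightarrow> 0"])
    let ?h = "\<lambda>v. case \<mu> v of Val a \<Rightarrow> a | Top \<Rightarrow> 0"
    show "Q \<subseteq> positions G" using I(4) by blast
    have pot: "w \<in> D \<or> ?h v \<le> ?h w + delta (prio G v)"
      if "v \<in> Q - D" "w \<in> Q" "\<mu> v \<le> stretch G (\<mu> w) v" for v w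
    proof (cases "\<mu> w")
      case (Val b)
      have v: "v \<in> P" "\<mu> v \<noteq> Top" using that I(4) by auto
      then obtain a where "\<mu> v = Val a" by (cases "\<mu> v") auto
      with potential_le[OF v(1) this Val that(3)] Val show ?thesis by simp
    next
      case Top
      with that I(4) show ?thesis by blast
    qed
    fix v assume v: "v \<in> Q - D"
    then have vP: "v \<in> P" "\<mu> v \<noteq> Top" using I(4) by auto
    show "\<exists>w \<in> succs G v \<inter> Q. w \<in> D \<or> ?h v \<le> ?h w + delta (prio G v)" if "v \<in> pos0 G"
    proof -
      from esc v that obtain w where w: "w \<in> succs G v \<inter> Q" "\<not> stretch G (\<nu> w) v < \<nu> v"
        by (auto simp: esc_def)
      then have "\<mu> v \<le> stretch G (\<mu> w) v" using I(5) v by auto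
      with pot[OF v] w show ?thesis by blast
    qed
    show "w \<in> Q \<and> (w \<in> D \<or> ?h v \<le> ?h w + delta (prio G v))"
      if "v \<in> pos1 G" "w \<in> succs G v" for w
    proof -
      have "w \<in> Q" using esc v that by (auto simp: esc_def)
      with pot[OF v] regress(2)[OF vP that] show ?thesis by blast
    qed
  qed
  moreover have "\<exists>w \<in> succs G v. \<rho> v \<le> stretch G (\<rho> w) v"
    if v: "v \<in> positions G" "\<rho> v \<noteq> Bot" "\<rho> v \<noteq> Top" "v \<in> pos0 G" for v
  proof -
    have "v \<in> P - Q" using v nonBot top by blast
    from I(9)[OF this v(4)] obtain w where "w \<in> succs G v - Q" "\<nu> v \<le> stretch G (\<nu> w) v" by blast
    with \<open>v \<in> P - Q\<close> show ?thesis by (auto simp: \<rho>_def)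
  qed
  moreover have "\<rho> v \<le> stretch G (\<rho> w) v"
    if v: "v \<in> positions G" "\<rho> v \<noteq> Bot" "\<rho> v \<noteq> Top" "v \<in> pos1 G" and w: "w \<in> succs G v" for v w
  proof -
    have "v \<in> P - Q" using v nonBot top by blast
    \<comment> \<open>Successors remaining in \<open>Q\<close> now have measure \<open>Top\<close>,
      which is why the invariant asks for regress only towards successors outside
      \<open>Q\<close>.\<close>
    with I(10)[OF this v(4), of w] w show ?thesis by (cases "w \<in> Q") (auto simp: \<rho>_def)
  qed
  ultimately show "\<rho> \<in> SQDMF G"
    unfolding SQDMF_iff[OF game] top by blast
qed

text \<open>Once \<open>bep\<close> is empty, \<open>lift\<close> and the set difference act as the
  identity, so the invariant holds at every index, in particular at the stopping index.\<close>

lemma prg_plus_seq_inv: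
  "\<exists>f. inv (fst (prg_plus_seq G \<mu> i)) (snd (prg_plus_seq G \<mu> i)) f \<and>
    bounded (fst (prg_plus_seq G \<mu> i)) (snd (prg_plus_seq G \<mu> i)) f"
proof (induction i)
  case 0
  then show ?case using inv_init bounded_init by (auto simp: SMF_D_plus[OF game smf])
next
  case (Suc i)
  obtain \<nu> Q where i: "prg_plus_seq G \<mu> i = (\<nu>, Q)" by fastforce
  with Suc obtain f where f: "inv \<nu> Q f" "bounded \<nu> Q f" by auto
  show ?case
  proof (cases "bep G \<nu> Q = {}")
    case True
    then have "prg_plus_seq G \<mu> (Suc i) = (\<nu>, Q)" using i by (simp add: lift_def Let_def)
    with f show ?thesis by auto
  next
    case False
    from prg_plus_step[OF f this] i show ?thesis by (simp add: Let_def)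
  qed
qed

lemma prg_plus_SQDMF: "prg_plus G \<mu> \<in> SQDMF G" and prg_plus_le: "MF_le G \<mu> (prg_plus G \<mu>)"
proof -
  let ?\<nu> = "\<lambda>i. fst (prg_plus_seq G \<mu> i)" and ?Q = "\<lambda>i. snd (prg_plus_seq G \<mu> i)"
  let ?stop = "\<lambda>k. bep G (?\<nu> k) (?Q k) = {}"
  have Q_Suc: "?Q (Suc i) = ?Q i - bep G (?\<nu> i) (?Q i)" for i
    by (simp add: Let_def case_prod_unfold)
  have fin: "finite (?Q i)" for i
  proof -
    have "?Q i \<subseteq> positions G" using prg_plus_seq_inv[of i] invD(4) by blast
    then show ?thesis using finite_positions finite_subset by blast
  qed
  \<comment> \<open>Each round before stopping removes a position from a finite set. Existence of a
    stopping index gives the \<open>LEAST\<close> in \<open>prg_plus\<close> its meaning.\<close>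
  have "\<exists>k. ?stop k"
  proof (rule ccontr)
    assume no: "\<nexists>k. ?stop k"
    have "card (?Q i) + i \<le> card (?Q 0)" for i
    proof (induction i)
      case (Suc i)
      have "bep G (?\<nu> i) (?Q i) \<subseteq> ?Q i" by (auto simp: bep_def esc_def)
      with no have "?Q (Suc i) \<subset> ?Q i" unfolding Q_Suc by blast
      then have "card (?Q (Suc i)) < card (?Q i)" using fin by (intro psubset_card_mono)
      with Suc show ?case by linarith
    qed simp
    from this[of "Suc (card (?Q 0))"] show False by simp
  qed
  then have stop: "?stop (LEAST k. ?stop k)" by (rule LeastI_ex)
  obtain f where "inv (?\<nu> (LEAST k. ?stop k)) (?Q (LEAST k. ?stop k)) f"
    using prg_plus_seq_inv by blast
  note final = prg_plus_final[OF this stop]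
  have "prg_plus G \<mu> = (\<lambda>v. if v \<in> ?Q (LEAST k. ?stop k) then Top else ?\<nu> (LEAST k. ?stop k) v)"
    by (simp add: prg_plus_def Let_def case_prod_unfold)
  with final show "prg_plus G \<mu> \<in> SQDMF G" "MF_le G \<mu> (prg_plus G \<mu>)" by simp_all
qed

end

section \<open>The solver\<close>

lemma MF_le_trans: "MF_le G \<mu> \<nu> \<Longrightarrow> MF_le G \<nu> \<rho> \<Longrightarrow> MF_le G \<mu> \<rho>"
  unfolding MF_le_def using order_trans by blast

lemma MF_le_antisym:
  assumes "\<mu> \<in> MF G" "\<nu> \<in> MF G" "MF_le G \<mu> \<nu>" "MF_le G \<nu> \<mu>"
  shows "\<mu> = \<nu>"
  using assms unfolding MF_def MF_le_def by (intro PiE_ext[of \<mu> _ _ \<nu>]) (auto intro: antisym)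

lemma solver_step:
  assumes "parity_game G" "\<mu> \<in> SQDMF G"
  shows "solver_step G \<mu> \<in> SQDMF G" and "MF_le G \<mu> (solver_step G \<mu>)"
proof -
  interpret A: sqdm G \<mu> using assms by unfold_locales
  \<comment> \<open>The facts on \<open>prg_plus\<close> are needed at the intermediate measure
    function, which must itself lie in \<open>SQDMF\<close>.\<close>
  interpret B: sqdm G "prg_bot G \<mu>" using assms A.prg_bot_SQDMF by unfold_locales
  show "solver_step G \<mu> \<in> SQDMF G"
    using B.prg_plus_SQDMF by (simp add: solver_step_def)
  have "MF_le G \<mu> (prg_bot G \<mu>)" using A.prg_bot_le by (simp add: MF_le_def)
  then show "MF_le G \<mu> (solver_step G \<mu>)"
    using B.prg_plus_le MF_le_trans by (auto simp: solver_step_def)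
qed

lemma card_le_depth:
  assumes "finite A" "C \<subseteq> A" "Complete_Partial_Order.chain le C"
  shows "card C \<le> depth A le"
  unfolding depth_def
proof (rule Max_ge)
  have "{card C |C. C \<subseteq> A \<and> Complete_Partial_Order.chain le C} \<subseteq> card ` Pow A" by blast
  then show "finite {card C |C. C \<subseteq> A \<and> Complete_Partial_Order.chain le C}"
    using assms(1) finite_subset by blast
qed (use assms in blast)

lemma solver_step_fixpoint:
  assumes G: "parity_game G" and \<mu>: "\<mu> \<in> SQDMF G"
  shows "\<exists>k \<le> depth (SMF G) (MF_le G).
    solver_step G ((solver_step G ^^ k) \<mu>) = (solver_step G ^^ k) \<mu>"
proof (rule ccontr)
  define s where "s k = (solver_step G ^^ k) \<mu>" for k
  let ?d = "depth (SMF G) (MF_le G)"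
  assume "\<not> ?thesis"
  then have strict: "s (Suc k) \<noteq> s k" if "k \<le> ?d" for k
    using that by (auto simp: s_def)
  have s: "s k \<in> SQDMF G" for k
    by (induction k) (auto simp: s_def \<mu> intro: solver_step[OF G])
  have incr: "MF_le G (s i) (s j)" if "i \<le> j" for i j
    using that
  proof (induction rule: dec_induct)
    case (step n)
    have "MF_le G (s n) (s (Suc n))"
      using solver_step(2)[OF G s[of n]] by (simp add: s_def)
    with step show ?case using MF_le_trans by blast
  qed (simp add: MF_le_def)
  have s_MF: "s k \<in> MF G" for k using s by (auto simp: SQDMF_def SMF_def)
  \<comment> \<open>Increasing iterates squeeze: if \<open>s i\<close> and \<open>s j\<close> agree,
    so do all between, in particular \<open>s i\<close> and \<open>s (Suc i)\<close>.\<close>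
  have "s i \<noteq> s j" if "i < j" "j \<le> ?d" for i j
  proof
    assume "s i = s j"
    then have "MF_le G (s (Suc i)) (s i)" using incr[of "Suc i" j] that by simp
    then have "s (Suc i) = s i" using incr[of i "Suc i"] by (intro MF_le_antisym[OF s_MF s_MF]) auto
    with strict[of i] that show False by simp
  qed
  then have "inj_on s {..?d}"
    by (intro inj_onI) (metis atMost_iff linorder_neqE_nat)
  \<comment> \<open>The index 0 counts, so there is one iterate more than a chain can hold.\<close>
  then have "card (s ` {..?d}) = Suc ?d" by (simp add: card_image)
  moreover have "card (s ` {..?d}) \<le> ?d"
  proof (rule card_le_depth[OF finite_SMF[OF G]])
    show "s ` {..?d} \<subseteq> SMF G" using s by (auto simp: SQDMF_def)
    show "Complete_Partial_Order.chain (MF_le G) (s ` {..?d})"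
      unfolding chain_def using incr by (metis imageE nat_le_linear)
  qed
  ultimately show False by simp
qed

text \<open>Two eventual values coincide from the larger threshold on; this justifies the definite
  description in \<open>sol\<close>.\<close>

lemma stationary_value_unique:
  "stationary_value f x y \<Longrightarrow> stationary_value f x z \<Longrightarrow> y = z"
  unfolding stationary_value_def by (metis nat_le_linear)

lemma stationary_value_fixpoint:
  assumes "f ((f ^^ k) x) = (f ^^ k) x"
  shows "stationary_value f x ((f ^^ k) x)"
  unfolding stationary_value_def
proof (intro exI allI impI)
  fix n assume "k \<le> n"
  then show "(f ^^ n) x = (f ^^ k) x"
    by (induction rule: dec_induct) (simp_all add: assms)
qed

theorem theorem26:
  fixes G :: "'v game"
  assumes "parity_game G"
  shows "(\<forall>\<mu> \<in> SQDMF G. \<exists>!\<nu>. stationary_value (solver_step G) \<mu> \<nu>) \<and>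
         sol G \<in> SQDMF G \<rightarrow> SQDMF G \<and>
         (\<forall>\<mu> \<in> SQDMF G. \<exists>k \<le> depth (SMF G) (MF_le G). sol G \<mu> = (solver_step G ^^ k) \<mu>)"
proof -
  have main: "(\<exists>!\<nu>. stationary_value (solver_step G) \<mu> \<nu>) \<and>
      (\<exists>k \<le> depth (SMF G) (MF_le G). sol G \<mu> = (solver_step G ^^ k) \<mu>)" if \<mu>: "\<mu> \<in> SQDMF G" for \<mu>
  proof -
    obtain k where k: "k \<le> depth (SMF G) (MF_le G)"
      "solver_step G ((solver_step G ^^ k) \<mu>) = (solver_step G ^^ k) \<mu>"
      using solver_step_fixpoint[OF assms \<mu>] by blast
    note st = stationary_value_fixpoint[of "solver_step G", OF k(2)]
    have "sol G \<mu> = (solver_step G ^^ k) \<mu>"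
      unfolding sol_def using st stationary_value_unique[OF _ st] by (rule the_equality)
    moreover have "\<exists>!\<nu>. stationary_value (solver_step G) \<mu> \<nu>"
      using st stationary_value_unique[OF _ st] by (rule ex1I)
    ultimately show ?thesis using k(1) by blast
  qed
  moreover have "(solver_step G ^^ k) \<mu> \<in> SQDMF G" if "\<mu> \<in> SQDMF G" for \<mu> k
    using that by (induction k) (auto intro: solver_step[OF assms])
  moreover from this main have "sol G \<in> SQDMF G \<rightarrow> SQDMF G"
    by (metis (no_types, lifting) Pi_I)
  ultimately show ?thesis by blast
qed

end
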